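(* Let $R$ be a commutative ring with unit, let $\mathbf{X}$ be a simplicial complex with a ground set $V$ of size $n$, and let $\mathbf{X}^*$ be its Alexander dual. Then for every integer $i$, $$\tilde H_i(\mathbf{X};R)\cong \tilde H^{\,n-i-3}(\mathbf{X}^*;R),$$ where the left side is reduced homology and the right side is reduced cohomology, both over $R$.
   Context: A simplicial complex $\mathbf{X}$ with finite ground set $V$ is a family of subsets of $V$ closed under taking subsets. Elements of $V$ need not be vertices of $\mathbf{X}$, and the empty family is allowed. Put $\overline{\sigma}=V\setminus\sigma$ and $\dim\sigma=|\sigma|-1$ (so $\dim\emptyset=-1$). The Alexander dual of $\mathbf{X}$ is the simplicial complex on the same ground set $V$ given by $\mathbf{X}^*=\{\sigma\subseteq V : \overline{\sigma}\notin\mathbf{X}\}$. Identify $V$ with $\{1,2,\dots,n\}$. For $j\in\sigma\subseteq V$ let $\operatorname{sgn}(j,\sigma)=(-1)^{r-1}$, where $j$ is the $r$-th smallest element of $\sigma$. We write $\sigma\setminus j$ and $\sigma\cup j$ for $\sigma\setminus\{j\}$ and $\sigma\cup\{j\}$. Reduced homology: for $i\in\mathbb{Z}$ let $C_i(\mathbf{X})$ be the free $R$-module with basis $\{e_\sigma : \sigma\in\mathbf{X},\ \dim\sigma=i\}$, and let $\partial_i:C_i(\mathbf{X})\to C_{i-1}(\mathbf{X})$ be given by $\partial_i(e_\sigma)=\sum_{j\in\sigma}\operatorname{sgn}(j,\sigma)e_{\sigma\setminus j}$ (in particular $\partial_{-1}=0$, as $C_{-2}(\mathbf{X})=0$). Then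 $\tilde H_i(\mathbf{X};R)=\ker\partial_i/\operatorname{im}\partial_{i+1}$. Reduced cohomology (defined in the same way for any simplicial complex, in particular for $\mathbf{X}^*$): for $i\in\mathbb{Z}$ let $C^i(\mathbf{X})$ be the free $R$-module with basis $\{e^*_\sigma : \sigma\in\mathbf{X},\ \dim\sigma=i\}$, and let $\partial^i:C^{i-1}(\mathbf{X})\to C^{i}(\mathbf{X})$ be given by $\partial^i(e^*_\sigma)=\sum_{j\notin\sigma,\ \sigma\cup j\in\mathbf{X}}\operatorname{sgn}(j,\sigma\cup j)e^*_{\sigma\cup j}$. Then $\tilde H^i(\mathbf{X};R)=\ker\partial^{i+1}/\operatorname{im}\partial^i$.
   Formalization: The ground set V is assumed nonempty (n ≥ 1); for n = 0 and R nonzero the claim fails, e.g. X the empty family has X* = {∅}, and for i = −2 the left side is 0 while the right side is R. *)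

theory Defs
  imports "HOL-Algebra.Module" "HOL-Algebra.AbelCoset" "HOL-Algebra.QuotRing"
begin

section \<open>Simplicial complexes on a finite ground set\<close>

text \<open>The empty family is a complex, distinct from the complex consisting of the empty face
  only, and elements of the ground set need not be vertices.\<close>

definition simplicial_complex_on :: "'v set \<Rightarrow> 'v set set \<Rightarrow> bool" where
  "simplicial_complex_on V X \<longleftrightarrow>
     finite V \<and> X \<subseteq> Pow V \<and> (\<forall>\<sigma>\<in>X. \<forall>\<tau>. \<tau> \<subseteq> \<sigma> \<longrightarrow> \<tau> \<in> X)"

definition alexander_dual :: "'v set \<Rightarrow> 'v set set \<Rightarrow> 'v set set" where
  "alexander_dual V X = {\<sigma>. \<sigma> \<subseteq> V \<and> V - \<sigma> \<notin> X}"

lemma simplicial_complex_on_alexander_dual: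
  assumes "simplicial_complex_on V X"
  shows "simplicial_complex_on V (alexander_dual V X)"
  unfolding simplicial_complex_on_def
proof (intro conjI ballI allI impI)
  show "finite V"
    using assms by (simp add: simplicial_complex_on_def)
  show "alexander_dual V X \<subseteq> Pow V"
    by (auto simp: alexander_dual_def)
  fix \<sigma> \<tau>
  assume "\<sigma> \<in> alexander_dual V X" and "\<tau> \<subseteq> \<sigma>"
  then have "\<tau> \<subseteq> V" "V - \<sigma> \<subseteq> V - \<tau>" "V - \<sigma> \<notin> X"
    by (auto simp: alexander_dual_def)
  then have "V - \<tau> \<notin> X"
    using assms unfolding simplicial_complex_on_def by blast
  then show "\<tau> \<in> alexander_dual V X"
    using \<open>\<tau> \<subseteq> V\<close> by (simp add: alexander_dual_def)
qed

definition face_dim :: "'v set \<Rightarrow> int" where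
  "face_dim \<sigma> = int (card \<sigma>) - 1"

definition faces :: "'v set set \<Rightarrow> int \<Rightarrow> 'v set set" where
  "faces X i = {\<sigma> \<in> X. face_dim \<sigma> = i}"

text \<open>The ground set is identified with \<open>{1..n}\<close> through a bijection \<open>\<nu>\<close>; the element \<open>j\<close>
  is the \<open>r\<close>-th smallest one of \<open>\<sigma>\<close> for \<open>r = card {k \<in> \<sigma>. \<nu> k \<le> \<nu> j}\<close>.\<close>

definition face_sgn ::
  "('r, 'm) ring_scheme \<Rightarrow> ('v \<Rightarrow> nat) \<Rightarrow> 'v \<Rightarrow> 'v set \<Rightarrow> 'r" where
  "face_sgn R \<nu> j \<sigma> = (\<ominus>\<^bsub>R\<^esub> \<one>\<^bsub>R\<^esub>) [^]\<^bsub>R\<^esub> (card {k \<in> \<sigma>. \<nu> k \<le> \<nu> j} - 1)"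


section \<open>Modules\<close>

text \<open>A \<^typ>\<open>('r, 'b) module\<close> record extends a ring record, but the \<^locale>\<open>module\<close>
  locale does not constrain its multiplicative part, which is left undefined here.\<close>

definition free_module :: "('r, 'm) ring_scheme \<Rightarrow> 'b set \<Rightarrow> ('r, 'b \<Rightarrow> 'r) module" where
  "free_module R B =
     \<lparr>carrier = {f. (\<forall>b\<in>B. f b \<in> carrier R) \<and> (\<forall>b. b \<notin> B \<longrightarrow> f b = \<zero>\<^bsub>R\<^esub>) \<and>
                    finite {b. f b \<noteq> \<zero>\<^bsub>R\<^esub>}},
      mult = undefined, one = undefined,
      zero = (\<lambda>b. \<zero>\<^bsub>R\<^esub>),
      add = (\<lambda>f g b. f b \<oplus>\<^bsub>R\<^esub> g b),
      smult = (\<lambda>a f b. a \<otimes>\<^bsub>R\<^esub> f b)\<rparr>"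

definition basis_vec :: "('r, 'm) ring_scheme \<Rightarrow> 'b \<Rightarrow> 'b \<Rightarrow> 'r" where
  "basis_vec R b = (\<lambda>c. if c = b then \<one>\<^bsub>R\<^esub> else \<zero>\<^bsub>R\<^esub>)"

lemma module_free_module:
  fixes R :: "('r, 'm) ring_scheme" and B :: "'b set"
  assumes "cring R"
  shows "module R (free_module R B)"
proof -
  interpret cring R by fact
  have fin: "finite {b. f b \<oplus>\<^bsub>R\<^esub> g b \<noteq> \<zero>\<^bsub>R\<^esub>}"
    if "finite {b. f b \<noteq> \<zero>\<^bsub>R\<^esub>}" "finite {b. g b \<noteq> \<zero>\<^bsub>R\<^esub>}" for f g :: "'b \<Rightarrow> 'r"
    by (rule finite_subset[OF _ finite_UnI[OF that]]) auto
  have fin': "finite {b. a \<otimes>\<^bsub>R\<^esub> f b \<noteq> \<zero>\<^bsub>R\<^esub>}"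
    if "a \<in> carrier R" "finite {b. f b \<noteq> \<zero>\<^bsub>R\<^esub>}" for a and f :: "'b \<Rightarrow> 'r"
    by (rule finite_subset[OF _ that(2)]) (use that(1) in auto)
  have car: "f b \<in> carrier R" if "f \<in> carrier (free_module R B)" for f b
    using that by (cases "b \<in> B") (auto simp: free_module_def)
  have inv: "\<exists>g\<in>carrier (free_module R B). g \<oplus>\<^bsub>free_module R B\<^esub> f = \<zero>\<^bsub>free_module R B\<^esub>"
    if f: "f \<in> carrier (free_module R B)" for f
  proof (rule bexI[of _ "\<lambda>b. \<ominus>\<^bsub>R\<^esub> f b"])
    show "(\<lambda>b. \<ominus>\<^bsub>R\<^esub> f b) \<oplus>\<^bsub>free_module R B\<^esub> f = \<zero>\<^bsub>free_module R B\<^esub>"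
      using car[OF f] by (simp add: free_module_def l_neg)
    have "finite {b. f b \<noteq> \<zero>\<^bsub>R\<^esub>}"
      using f by (simp add: free_module_def)
    then have "finite {b. \<ominus>\<^bsub>R\<^esub> f b \<noteq> \<zero>\<^bsub>R\<^esub>}"
      by (rule rev_finite_subset) auto
    then show "(\<lambda>b. \<ominus>\<^bsub>R\<^esub> f b) \<in> carrier (free_module R B)"
      using f by (simp add: free_module_def)
  qed
  show ?thesis
  proof (rule moduleI)
    show "abelian_group (free_module R B)"
    proof (rule abelian_groupI)
      fix f g h
      assume "f \<in> carrier (free_module R B)" "g \<in> carrier (free_module R B)"
        "h \<in> carrier (free_module R B)"
      note c = this[THEN car]
      show "f \<oplus>\<^bsub>free_module R B\<^esub> g \<oplus>\<^bsub>free_module R B\<^esub> h =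
            f \<oplus>\<^bsub>free_module R B\<^esub> (g \<oplus>\<^bsub>free_module R B\<^esub> h)"
        using c by (auto simp: free_module_def a_assoc)
    next
      fix f g
      assume "f \<in> carrier (free_module R B)" "g \<in> carrier (free_module R B)"
      note c = this[THEN car]
      show "f \<oplus>\<^bsub>free_module R B\<^esub> g = g \<oplus>\<^bsub>free_module R B\<^esub> f"
        using c by (auto simp: free_module_def a_comm)
    next
      fix f
      assume "f \<in> carrier (free_module R B)"
      note c = this[THEN car]
      show "\<zero>\<^bsub>free_module R B\<^esub> \<oplus>\<^bsub>free_module R B\<^esub> f = f"
        using c by (auto simp: free_module_def)
    next
      fix f g
      assume "f \<in> carrier (free_module R B)" "g \<in> carrier (free_module R B)"
      then show "f \<oplus>\<^bsub>free_module R B\<^esub> g \<in> carrier (free_module R B)"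
        using fin[of f g] by (simp add: free_module_def)
    next
      show "\<zero>\<^bsub>free_module R B\<^esub> \<in> carrier (free_module R B)"
        by (simp add: free_module_def)
    qed (fact inv)
  next
    fix a f
    assume "a \<in> carrier R" "f \<in> carrier (free_module R B)"
    then show "a \<odot>\<^bsub>free_module R B\<^esub> f \<in> carrier (free_module R B)"
      using fin'[of a f] by (simp add: free_module_def)
  next
    show "cring R"
      by fact
  next
    fix a f g
    assume "a \<in> carrier R" "f \<in> carrier (free_module R B)" "g \<in> carrier (free_module R B)"
    then show "a \<odot>\<^bsub>free_module R B\<^esub> (f \<oplus>\<^bsub>free_module R B\<^esub> g) =
        a \<odot>\<^bsub>free_module R B\<^esub> f \<oplus>\<^bsub>free_module R B\<^esub> a \<odot>\<^bsub>free_module R B\<^esub> g"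
      using car[of f] car[of g] by (simp add: free_module_def r_distr)
  next
    fix a b f
    assume "a \<in> carrier R" "b \<in> carrier R" "f \<in> carrier (free_module R B)"
    note c = this(1,2) car[OF this(3)]
    show "(a \<oplus>\<^bsub>R\<^esub> b) \<odot>\<^bsub>free_module R B\<^esub> f =
        a \<odot>\<^bsub>free_module R B\<^esub> f \<oplus>\<^bsub>free_module R B\<^esub> b \<odot>\<^bsub>free_module R B\<^esub> f"
      using c by (simp add: free_module_def l_distr)
    show "(a \<otimes>\<^bsub>R\<^esub> b) \<odot>\<^bsub>free_module R B\<^esub> f =
        a \<odot>\<^bsub>free_module R B\<^esub> (b \<odot>\<^bsub>free_module R B\<^esub> f)"
      using c by (simp add: free_module_def m_assoc)
  next
    fix f
    assume "f \<in> carrier (free_module R B)"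
    then show "\<one>\<^bsub>R\<^esub> \<odot>\<^bsub>free_module R B\<^esub> f = f"
      using car[of f] by (simp add: free_module_def)
  qed
qed

definition quotient_module :: "('r, 'a, 'm) module_scheme \<Rightarrow> 'a set \<Rightarrow> ('r, 'a set) module" where
  "quotient_module M N =
     \<lparr>carrier = a_rcosets\<^bsub>M\<^esub> N,
      mult = undefined, one = undefined,
      zero = N,
      add = set_add M,
      smult = (\<lambda>a A. \<Union>x\<in>A. N +>\<^bsub>M\<^esub> (a \<odot>\<^bsub>M\<^esub> x))\<rparr>"

definition linear_isos ::
  "('r, 'm) ring_scheme \<Rightarrow> ('r, 'a, 'p) module_scheme \<Rightarrow> ('r, 'b, 'q) module_scheme
     \<Rightarrow> ('a \<Rightarrow> 'b) set" where
  "linear_isos R M N =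
     {h. bij_betw h (carrier M) (carrier N) \<and>
         (\<forall>x\<in>carrier M. \<forall>y\<in>carrier M. h (x \<oplus>\<^bsub>M\<^esub> y) = h x \<oplus>\<^bsub>N\<^esub> h y) \<and>
         (\<forall>a\<in>carrier R. \<forall>x\<in>carrier M. h (a \<odot>\<^bsub>M\<^esub> x) = a \<odot>\<^bsub>N\<^esub> h x)}"

definition module_isomorphic ::
  "('r, 'm) ring_scheme \<Rightarrow> ('r, 'a, 'p) module_scheme \<Rightarrow> ('r, 'b, 'q) module_scheme
     \<Rightarrow> bool" where
  "module_isomorphic R M N \<longleftrightarrow> linear_isos R M N \<noteq> {}"


section \<open>Reduced homology and cohomology\<close>

text \<open>As modules, \<open>C\<^sub>i(X)\<close> and \<open>C\<^sup>i(X)\<close> are both free on the \<open>i\<close>-dimensional faces of \<open>X\<close>,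
  so one definition serves for both; \<^term>\<open>basis_vec R \<sigma>\<close> plays the role of the basis vector of
  \<open>\<sigma>\<close> in either.\<close>

definition chain_module ::
  "('r, 'm) ring_scheme \<Rightarrow> 'v set set \<Rightarrow> int \<Rightarrow> ('r, 'v set \<Rightarrow> 'r) module" where
  "chain_module R X i = free_module R (faces X i)"

text \<open>The map \<open>\<partial>\<^sub>i : C\<^sub>i(X) \<rightarrow> C\<^sub>i\<^sub>-\<^sub>1(X)\<close>, extended linearly from the basis. For \<open>i = - 1\<close> the
  only possible face is empty, so the inner sum is empty and the map vanishes.\<close>

definition boundary ::
  "('r, 'm) ring_scheme \<Rightarrow> ('v \<Rightarrow> nat) \<Rightarrow> 'v set set \<Rightarrow> int \<Rightarrow> ('v set \<Rightarrow> 'r)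
     \<Rightarrow> ('v set \<Rightarrow> 'r)" where
  "boundary R \<nu> X i f =
     (let C = chain_module R X (i - 1) in
      \<Oplus>\<^bsub>C\<^esub> \<sigma> \<in> faces X i. f \<sigma> \<odot>\<^bsub>C\<^esub>
        (\<Oplus>\<^bsub>C\<^esub> j \<in> \<sigma>. face_sgn R \<nu> j \<sigma> \<odot>\<^bsub>C\<^esub> basis_vec R (\<sigma> - {j})))"

text \<open>The map \<open>\<partial>\<^sup>i : C\<^sup>i\<^sup>-\<^sup>1(X) \<rightarrow> C\<^sup>i(X)\<close>; the index is that of the codomain.\<close>

definition coboundary ::
  "('r, 'm) ring_scheme \<Rightarrow> ('v \<Rightarrow> nat) \<Rightarrow> 'v set set \<Rightarrow> int \<Rightarrow> ('v set \<Rightarrow> 'r)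
     \<Rightarrow> ('v set \<Rightarrow> 'r)" where
  "coboundary R \<nu> X i f =
     (let C = chain_module R X i in
      \<Oplus>\<^bsub>C\<^esub> \<sigma> \<in> faces X (i - 1). f \<sigma> \<odot>\<^bsub>C\<^esub>
        (\<Oplus>\<^bsub>C\<^esub> j \<in> {j. j \<notin> \<sigma> \<and> insert j \<sigma> \<in> X}.
           face_sgn R \<nu> j (insert j \<sigma>) \<odot>\<^bsub>C\<^esub> basis_vec R (insert j \<sigma>)))"

definition reduced_homology ::
  "('r, 'm) ring_scheme \<Rightarrow> ('v \<Rightarrow> nat) \<Rightarrow> 'v set set \<Rightarrow> int
     \<Rightarrow> ('r, ('v set \<Rightarrow> 'r) set) module" where
  "reduced_homology R \<nu> X i =
     quotient_module
       (chain_module R X i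
          \<lparr>carrier := a_kernel (chain_module R X i) (chain_module R X (i - 1)) (boundary R \<nu> X i)\<rparr>)
       (boundary R \<nu> X (i + 1) ` carrier (chain_module R X (i + 1)))"

definition reduced_cohomology ::
  "('r, 'm) ring_scheme \<Rightarrow> ('v \<Rightarrow> nat) \<Rightarrow> 'v set set \<Rightarrow> int
     \<Rightarrow> ('r, ('v set \<Rightarrow> 'r) set) module" where
  "reduced_cohomology R \<nu> X i =
     quotient_module
       (chain_module R X i
          \<lparr>carrier := a_kernel (chain_module R X i) (chain_module R X (i + 1))
                        (coboundary R \<nu> X (i + 1))\<rparr>)
       (coboundary R \<nu> X i ` carrier (chain_module R X (i - 1)))"

end

theory Submission
  imports Defs
begin

text \<open>Alexander duality is proved on the level of chains, by comparing both sides with the homology of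
  the full simplex on \<open>V\<close> relative to \<open>X\<close>.

  The relative chain complex has the non-faces \<open>\<sigma> \<notin> X\<close> as its basis, and these are exactly the
  complements of the faces of the Alexander dual. A non-face of dimension \<open>j\<close> corresponds to a dual face of
  dimension \<open>n - j - 2\<close>, and removing a vertex from \<open>\<sigma>\<close> means inserting it into \<open>V - \<sigma>\<close>. Up to signs,
  the relative boundary map is thus the coboundary map of the dual. The two signs of a vertex \<open>j\<close>, in
  \<open>\<tau>\<close> and in \<open>(V - \<tau>) \<union> {j}\<close>, multiply to a sign that depends on \<open>j\<close> alone, so the discrepancy is
  absorbed by one sign for each face, the product of the signs of its vertices
  (\<open>dual_sgn_remove\<close>, \<open>coboundary_complement_chain\<close>).

  The full simplex is a cone over any of its vertices \<open>v\<close>, hence has vanishing reduced homology, and the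
  long exact sequence of the pair shows that the homology of \<open>X\<close> in degree \<open>i\<close> is the relative homology
  in degree \<open>i + 1\<close>, which accounts for the degree \<open>n - i - 3\<close>. Instead of the exact sequence, the proof
  uses the contracting homotopy itself: a cycle \<open>f\<close> of \<open>X\<close> is the boundary of its cone with apex \<open>v\<close>, and
  the part of that cone outside \<open>X\<close> is the relative cycle that corresponds to \<open>f\<close>
  (\<open>del_cone\<close> and the locale \<open>contracted_complex\<close>).

  Composing the two steps gives one linear map from cycles of \<open>X\<close> to cocycles of the dual. It pulls
  coboundaries back to exactly the boundaries and hits every cocycle up to a coboundary, which is all that
  an isomorphism of the quotients requires (\<open>module_isomorphic_quotientsI\<close>).\<close>

section \<open>Linear maps and quotient modules\<close>

definition linear_map ::
  "('r, 'm) ring_scheme \<Rightarrow> ('r, 'a, 'p) module_scheme \<Rightarrow> ('r, 'b, 'q) module_scheme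
     \<Rightarrow> ('a \<Rightarrow> 'b) \<Rightarrow> bool" where
  "linear_map R M N h \<longleftrightarrow>
     h \<in> carrier M \<rightarrow> carrier N \<and>
     (\<forall>x\<in>carrier M. \<forall>y\<in>carrier M. h (x \<oplus>\<^bsub>M\<^esub> y) = h x \<oplus>\<^bsub>N\<^esub> h y) \<and>
     (\<forall>a\<in>carrier R. \<forall>x\<in>carrier M. h (a \<odot>\<^bsub>M\<^esub> x) = a \<odot>\<^bsub>N\<^esub> h x)"

lemma linear_mapI:
  assumes "\<And>x. x \<in> carrier M \<Longrightarrow> h x \<in> carrier N"
    and "\<And>x y. x \<in> carrier M \<Longrightarrow> y \<in> carrier M \<Longrightarrow> h (x \<oplus>\<^bsub>M\<^esub> y) = h x \<oplus>\<^bsub>N\<^esub> h y"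
    and "\<And>a x. a \<in> carrier R \<Longrightarrow> x \<in> carrier M \<Longrightarrow> h (a \<odot>\<^bsub>M\<^esub> x) = a \<odot>\<^bsub>N\<^esub> h x"
  shows "linear_map R M N h"
  using assms by (auto simp: linear_map_def)

lemma linear_mapD:
  assumes "linear_map R M N h"
  shows "x \<in> carrier M \<Longrightarrow> h x \<in> carrier N"
    and "x \<in> carrier M \<Longrightarrow> y \<in> carrier M \<Longrightarrow> h (x \<oplus>\<^bsub>M\<^esub> y) = h x \<oplus>\<^bsub>N\<^esub> h y"
    and "a \<in> carrier R \<Longrightarrow> x \<in> carrier M \<Longrightarrow> h (a \<odot>\<^bsub>M\<^esub> x) = a \<odot>\<^bsub>N\<^esub> h x"
  using assms by (auto simp: linear_map_def)

lemma linear_map_cong: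
  assumes "module R M" and "linear_map R M N h" and "\<And>x. x \<in> carrier M \<Longrightarrow> g x = h x"
  shows "linear_map R M N g"
proof -
  interpret module R M by fact
  show ?thesis
    by (rule linear_mapI) (simp_all add: assms(3) linear_mapD[OF assms(2)])
qed

lemma linear_map_compose:
  assumes "linear_map R L M g" "linear_map R M N h"
  shows "linear_map R L N (\<lambda>x. h (g x))"
  using linear_mapD[OF assms(1)] linear_mapD[OF assms(2)] by (intro linear_mapI) simp_all

lemma linear_map_restrict_carrier:
  assumes "linear_map R M N h" "K \<subseteq> carrier M" "\<And>x. x \<in> K \<Longrightarrow> h x \<in> K'"
  shows "linear_map R (M\<lparr>carrier := K\<rparr>) (N\<lparr>carrier := K'\<rparr>) h"
  using linear_mapD(2,3)[OF assms(1)] assms(2,3) by (intro linear_mapI) (auto simp: subset_iff)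

lemma linear_map_imp_abelian_group_hom:
  assumes "module R M" "module R N" "linear_map R M N h"
  shows "abelian_group_hom M N h"
proof -
  interpret M: module R M by fact
  interpret N: module R N by fact
  show ?thesis
    by (rule abelian_group_homI)
      (auto simp: hom_def linear_mapD[OF assms(3)] intro: M.abelian_group_axioms N.abelian_group_axioms
        M.a_group N.a_group intro!: group_hom.intro group_hom_axioms.intro)
qed

lemma mem_a_kernel: "x \<in> a_kernel M N h \<longleftrightarrow> x \<in> carrier M \<and> h x = \<zero>\<^bsub>N\<^esub>"
  unfolding a_kernel_def' by blast

lemma submodule_kernel:
  assumes "module R M" "module R N" "linear_map R M N h"
  shows "submodule (a_kernel M N h) R M"
proof -
  interpret M: module R M by fact
  interpret N: module R N by fact
  interpret h: abelian_group_hom M N h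
    by (rule linear_map_imp_abelian_group_hom) fact+
  show ?thesis
  proof (rule M.submoduleI)
    show "a_kernel M N h \<subseteq> carrier M"
      unfolding a_kernel_def' by blast
    show "\<zero>\<^bsub>M\<^esub> \<in> a_kernel M N h"
      unfolding a_kernel_def' using h.hom_zero by blast
    show "\<ominus>\<^bsub>M\<^esub> x \<in> a_kernel M N h" if "x \<in> a_kernel M N h" for x
      using that unfolding a_kernel_def' by simp
    show "x \<oplus>\<^bsub>M\<^esub> y \<in> a_kernel M N h" if "x \<in> a_kernel M N h" "y \<in> a_kernel M N h" for x y
      using that unfolding a_kernel_def' by simp
    show "a \<odot>\<^bsub>M\<^esub> x \<in> a_kernel M N h" if "a \<in> carrier R" "x \<in> a_kernel M N h" for a x
      using that unfolding a_kernel_def' by (simp add: linear_mapD(3)[OF assms(3)])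
  qed
qed

lemma submodule_image:
  assumes "module R M" "module R N" "linear_map R M N h"
  shows "submodule (h ` carrier M) R N"
proof -
  interpret M: module R M by fact
  interpret N: module R N by fact
  interpret h: abelian_group_hom M N h
    by (rule linear_map_imp_abelian_group_hom) fact+
  show ?thesis
  proof (rule N.submoduleI)
    show "\<zero>\<^bsub>N\<^esub> \<in> h ` carrier M"
      by (rule image_eqI[of _ _ "\<zero>\<^bsub>M\<^esub>"]) auto
    show "\<ominus>\<^bsub>N\<^esub> a \<in> h ` carrier M" if a: "a \<in> h ` carrier M" for a
    proof -
      from a obtain x where "x \<in> carrier M" "a = h x" by auto
      then show ?thesis by (intro image_eqI[of _ _ "\<ominus>\<^bsub>M\<^esub> x"]) auto
    qed
    show "a \<oplus>\<^bsub>N\<^esub> b \<in> h ` carrier M" if a: "a \<in> h ` carrier M" "b \<in> h ` carrier M" for a b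
    proof -
      from a obtain x y where "x \<in> carrier M" "a = h x" "y \<in> carrier M" "b = h y" by auto
      then show ?thesis by (intro image_eqI[of _ _ "x \<oplus>\<^bsub>M\<^esub> y"]) auto
    qed
    show "a \<odot>\<^bsub>N\<^esub> b \<in> h ` carrier M" if a: "a \<in> carrier R" "b \<in> h ` carrier M" for a b
    proof -
      from a obtain x where "x \<in> carrier M" "b = h x" by auto
      then show ?thesis using a
        by (intro image_eqI[of _ _ "a \<odot>\<^bsub>M\<^esub> x"]) (auto simp: linear_mapD(3)[OF assms(3)])
    qed
  qed auto
qed

lemma submodule_restrict_carrier:
  assumes "module R M" "submodule K R M" "submodule B R M" "B \<subseteq> K"
  shows "submodule B R (M\<lparr>carrier := K\<rparr>)"
proof -
  interpret K: module R "M\<lparr>carrier := K\<rparr>"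
    using assms by (intro submodule.submodule_is_module)
  have "module R (M\<lparr>carrier := B\<rparr>)"
    using assms by (intro submodule.submodule_is_module)
  then show ?thesis
    using \<open>B \<subseteq> K\<close> by (intro K.module_incl_imp_submodule) auto
qed

lemma submodule_imp_abelian_subgroup:
  assumes "module R M" "submodule B R M"
  shows "abelian_subgroup B M"
proof -
  interpret module R M by fact
  show ?thesis
    using assms(2) by (intro abelian_subgroupI3 additive_subgroup.intro abelian_group_axioms)
      (rule submodule.axioms)
qed

text \<open>An additive map that carries one submodule into another takes a constant value on each
  coset, once its values are read modulo the target submodule. Both the scalar multiplication of
  a quotient module and the map induced on quotients are unions of this kind.\<close>

lemma Union_cosets_eq:
  assumes M: "module R M" "submodule B R M" and N: "module R N" "submodule B' R N"
    and h: "\<And>y. y \<in> carrier M \<Longrightarrow> h y \<in> carrier N"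
      "\<And>y z. y \<in> carrier M \<Longrightarrow> z \<in> carrier M \<Longrightarrow> h (y \<oplus>\<^bsub>M\<^esub> z) = h y \<oplus>\<^bsub>N\<^esub> h z"
      "\<And>b. b \<in> B \<Longrightarrow> h b \<in> B'"
    and x: "x \<in> carrier M"
  shows "(\<Union>y\<in>B +>\<^bsub>M\<^esub> x. B' +>\<^bsub>N\<^esub> h y) = B' +>\<^bsub>N\<^esub> h x"
proof -
  interpret M: module R M by fact
  interpret N: module R N by fact
  interpret B: abelian_subgroup B M by (rule submodule_imp_abelian_subgroup) fact+
  interpret B': abelian_subgroup B' N by (rule submodule_imp_abelian_subgroup) fact+
  have "B' +>\<^bsub>N\<^esub> h y = B' +>\<^bsub>N\<^esub> h x" if "y \<in> B +>\<^bsub>M\<^esub> x" for y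
  proof -
    from that obtain b where b: "b \<in> B" "y = b \<oplus>\<^bsub>M\<^esub> x"
      by (auto simp: a_r_coset_def')
    then have "h y \<in> B' +>\<^bsub>N\<^esub> h x"
      using h x by (auto simp: a_r_coset_def')
    then show ?thesis
      using B'.a_repr_independence'[of "h y" "h x"] h(1)[OF x] by simp
  qed
  moreover have "x \<in> B +>\<^bsub>M\<^esub> x"
    using x by (rule B.a_rcos_self)
  ultimately show ?thesis by blast
qed

text \<open>The map induced by \<open>h\<close> sends a coset \<open>A\<close> to the union of the cosets of \<open>h y\<close> for \<open>y \<in> A\<close>,
  which is one coset by the previous lemma.\<close>

lemma module_isomorphic_quotientsI:
  assumes M: "module R M" "submodule B R M" and N: "module R N" "submodule B' R N"
    and h: "linear_map R M N h"
    and ker: "\<And>x. x \<in> carrier M \<Longrightarrow> h x \<in> B' \<longleftrightarrow> x \<in> B"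
    and onto: "\<And>y. y \<in> carrier N \<Longrightarrow> \<exists>x\<in>carrier M. y \<in> B' +>\<^bsub>N\<^esub> h x"
  shows "module_isomorphic R (quotient_module M B) (quotient_module N B')"
proof -
  interpret M: module R M by fact
  interpret N: module R N by fact
  interpret B: abelian_subgroup B M by (rule submodule_imp_abelian_subgroup) fact+
  interpret B': abelian_subgroup B' N by (rule submodule_imp_abelian_subgroup) fact+
  interpret h: abelian_group_hom M N h
    by (rule linear_map_imp_abelian_group_hom) fact+
  define H where "H = (\<lambda>A. \<Union>y\<in>A. B' +>\<^bsub>N\<^esub> h y)"
  have H: "H (B +>\<^bsub>M\<^esub> x) = B' +>\<^bsub>N\<^esub> h x" if "x \<in> carrier M" for x
    unfolding H_def using ker that B.a_subset by (intro Union_cosets_eq[OF M N]) auto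
  have smult_M: "(\<Union>y\<in>B +>\<^bsub>M\<^esub> x. B +>\<^bsub>M\<^esub> (a \<odot>\<^bsub>M\<^esub> y)) = B +>\<^bsub>M\<^esub> (a \<odot>\<^bsub>M\<^esub> x)"
    if "a \<in> carrier R" "x \<in> carrier M" for a x
    using that by (intro Union_cosets_eq[OF M M] M.smult_closed M.smult_r_distr M.submoduleE(4)[OF M(2)])
  have smult_N: "(\<Union>y\<in>B' +>\<^bsub>N\<^esub> x. B' +>\<^bsub>N\<^esub> (a \<odot>\<^bsub>N\<^esub> y)) = B' +>\<^bsub>N\<^esub> (a \<odot>\<^bsub>N\<^esub> x)"
    if "a \<in> carrier R" "x \<in> carrier N" for a x
    using that by (intro Union_cosets_eq[OF N N] N.smult_closed N.smult_r_distr N.submoduleE(4)[OF N(2)])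
  have inj: "B +>\<^bsub>M\<^esub> x = B +>\<^bsub>M\<^esub> y"
    if xy: "x \<in> carrier M" "y \<in> carrier M" and eq: "B' +>\<^bsub>N\<^esub> h x = B' +>\<^bsub>N\<^esub> h y" for x y
  proof -
    have "h x \<in> B' +>\<^bsub>N\<^esub> h y"
      using B'.a_rcos_self[of "h x"] xy eq by simp
    then have "h (x \<oplus>\<^bsub>M\<^esub> \<ominus>\<^bsub>M\<^esub> y) \<in> B'"
      using xy B'.a_rcos_module[of "h y" "h x"] by simp
    then have "x \<in> B +>\<^bsub>M\<^esub> y"
      using xy ker[of "x \<oplus>\<^bsub>M\<^esub> \<ominus>\<^bsub>M\<^esub> y"] B.a_rcos_module[of y x] by simp
    then show ?thesis
      using xy B.a_repr_independence'[of x y] by simp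
  qed
  have carrier_quotient: "carrier (quotient_module M B) = (\<lambda>x. B +>\<^bsub>M\<^esub> x) ` carrier M"
    "carrier (quotient_module N B') = (\<lambda>x. B' +>\<^bsub>N\<^esub> x) ` carrier N"
    by (auto simp: quotient_module_def A_RCOSETS_def')
  have "inj_on H (carrier (quotient_module M B))"
  proof (rule inj_onI)
    fix A C
    assume "A \<in> carrier (quotient_module M B)" "C \<in> carrier (quotient_module M B)" "H A = H C"
    then obtain x y where xy: "x \<in> carrier M" "y \<in> carrier M"
        "A = B +>\<^bsub>M\<^esub> x" "C = B +>\<^bsub>M\<^esub> y"
      unfolding carrier_quotient by blast
    with \<open>H A = H C\<close> show "A = C"
      using inj[OF xy(1,2)] H[OF xy(1)] H[OF xy(2)] by simp
  qed
  moreover have "H ` carrier (quotient_module M B) = carrier (quotient_module N B')"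
  proof (intro equalityI subsetI)
    fix Z assume "Z \<in> H ` carrier (quotient_module M B)"
    then obtain x where x: "x \<in> carrier M" "Z = H (B +>\<^bsub>M\<^esub> x)"
      unfolding carrier_quotient by blast
    then show "Z \<in> carrier (quotient_module N B')"
      unfolding carrier_quotient H[OF x(1)] by simp
  next
    fix Z assume "Z \<in> carrier (quotient_module N B')"
    then obtain y where y: "y \<in> carrier N" "Z = B' +>\<^bsub>N\<^esub> y"
      unfolding carrier_quotient by blast
    with onto obtain x where x: "x \<in> carrier M" "y \<in> B' +>\<^bsub>N\<^esub> h x" by blast
    then have "Z = H (B +>\<^bsub>M\<^esub> x)"
      using y B'.a_repr_independence'[of y "h x"] H[OF x(1)] by simp
    then show "Z \<in> H ` carrier (quotient_module M B)"
      unfolding carrier_quotient using x(1) by simp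
  qed
  ultimately have "bij_betw H (carrier (quotient_module M B)) (carrier (quotient_module N B'))"
    by (simp add: bij_betw_def)
  moreover have "H (A \<oplus>\<^bsub>quotient_module M B\<^esub> C) = H A \<oplus>\<^bsub>quotient_module N B'\<^esub> H C"
    if "A \<in> carrier (quotient_module M B)" "C \<in> carrier (quotient_module M B)" for A C
  proof -
    from that obtain x y where "x \<in> carrier M" "y \<in> carrier M" "A = B +>\<^bsub>M\<^esub> x" "C = B +>\<^bsub>M\<^esub> y"
      unfolding carrier_quotient by blast
    then show ?thesis
      by (simp add: quotient_module_def B.a_rcos_sum B'.a_rcos_sum H)
  qed
  moreover have "H (a \<odot>\<^bsub>quotient_module M B\<^esub> A) = a \<odot>\<^bsub>quotient_module N B'\<^esub> H A"
    if "a \<in> carrier R" "A \<in> carrier (quotient_module M B)" for a A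
  proof -
    from that obtain x where "x \<in> carrier M" "A = B +>\<^bsub>M\<^esub> x"
      unfolding carrier_quotient by blast
    then show ?thesis
      using that(1) by (simp add: quotient_module_def smult_M smult_N H linear_mapD(3)[OF h])
  qed
  ultimately show ?thesis
    by (auto simp: module_isomorphic_def linear_isos_def)
qed

section \<open>Relative cycles in a contracted complex\<close>

text \<open>The ambient complex with its differential \<open>D\<close> is contracted by the homotopy \<open>K\<close>. The kernel of
  \<open>P\<close> is a subcomplex \<open>A\<close>, and values of \<open>P\<close> represent chains modulo \<open>A\<close>, so that \<open>P \<circ> D\<close>
  is the relative differential; \<open>P_D_P\<close> says that it does not depend on the representative.
  The connecting map from relative cycles to cycles of \<open>A\<close> is \<open>D\<close>, and the lemmas below show that
  \<open>P \<circ> K\<close> inverts it up to boundaries. The group collects the chains of all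
  degrees.\<close>

locale contracted_complex = abelian_group G for G (structure) +
  fixes D K P
  assumes D_hom: "abelian_group_hom G G D"
    and K_hom: "abelian_group_hom G G K"
    and P_hom: "abelian_group_hom G G P"
    and D_D: "x \<in> carrier G \<Longrightarrow> D (D x) = \<zero>"
    and D_K: "x \<in> carrier G \<Longrightarrow> D (K x) \<oplus> K (D x) = x"
    and P_D_P: "x \<in> carrier G \<Longrightarrow> P (D (P x)) = P (D x)"
begin

sublocale D: abelian_group_hom G G D by (rule D_hom)
sublocale K: abelian_group_hom G G K by (rule K_hom)
sublocale P: abelian_group_hom G G P by (rule P_hom)

lemma cone_cycle:
  assumes "f \<in> carrier G" "D f = \<zero>"
  shows "D (K f) = f"
  using D_K[OF assms(1)] assms by simp

lemma relative_cycle_cone: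
  assumes "f \<in> carrier G" "D f = \<zero>" "P f = \<zero>"
  shows "P (D (P (K f))) = \<zero>"
  using assms by (simp add: P_D_P cone_cycle)

text \<open>Apply \<open>P\<close> to \<open>D (K u) \<oplus> K (D u) = u\<close>; the right-hand side dies because \<open>u\<close> lies in the
  subcomplex.\<close>

lemma relative_boundary_cone:
  assumes u: "u \<in> carrier G" "P u = \<zero>"
  shows "P (K (D u)) = P (D (P (K (\<ominus> u))))"
proof -
  have "P (D (K u)) \<oplus> P (K (D u)) = \<zero>"
    using D_K[OF u(1)] u by (metis D.hom_closed K.hom_closed P.hom_add)
  then have "P (K (D u)) = \<ominus> P (D (K u))"
    using u by (intro minus_equality[symmetric]) (simp_all add: a_comm)
  then show ?thesis
    using u by (simp add: P_D_P)
qed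

text \<open>\<open>K f\<close> bounds \<open>f\<close> in the ambient complex, and correcting it by
  the boundary \<open>D h\<close> moves it into the subcomplex without changing its own boundary.\<close>

lemma boundary_if_relative_boundary_cone:
  assumes f: "f \<in> carrier G" "D f = \<zero>" and h: "h \<in> carrier G"
    and eq: "P (K f) = P (D h)"
  shows "D (K f \<ominus> D h) = f" and "P (K f \<ominus> D h) = \<zero>"
  using assms by (simp_all add: a_minus_def cone_cycle D_D r_neg)

text \<open>If \<open>h\<close> is a relative cycle, then \<open>D h\<close> is a cycle of the subcomplex, and its image under \<open>P \<circ> K\<close>
  differs from \<open>h\<close> by a relative boundary.\<close>

lemma relative_cycle_homologous:
  assumes h: "h \<in> carrier G" "P h = h"
  shows "P (D (P (K h))) \<oplus> P (K (D h)) = h"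
proof -
  have "P (D (K h)) \<oplus> P (K (D h)) = h"
    using D_K[OF h(1)] h by (metis D.hom_closed K.hom_closed P.hom_add)
  then show ?thesis
    using h by (simp add: P_D_P)
qed

end

section \<open>Finite sums and free modules on finite sets\<close>

lemma (in abelian_monoid) finsum_swap:
  assumes "finite A" "finite B" "\<And>a b. a \<in> A \<Longrightarrow> b \<in> B \<Longrightarrow> f a b \<in> carrier G"
  shows "(\<Oplus>a\<in>A. \<Oplus>b\<in>B. f a b) = (\<Oplus>b\<in>B. \<Oplus>a\<in>A. f a b)"
  using assms(1,3)
proof (induction A)
  case empty
  then show ?case by simp
next
  case (insert x A)
  have "(\<Oplus>a\<in>insert x A. \<Oplus>b\<in>B. f a b) = (\<Oplus>b\<in>B. f x b) \<oplus> (\<Oplus>b\<in>B. \<Oplus>a\<in>A. f a b)"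
    using insert by (subst finsum_insert) (auto intro!: finsum_closed)
  also have "\<dots> = (\<Oplus>b\<in>B. f x b \<oplus> (\<Oplus>a\<in>A. f a b))"
    using insert by (subst finsum_addf) (auto intro!: finsum_closed)
  also have "\<dots> = (\<Oplus>b\<in>B. \<Oplus>a\<in>insert x A. f a b)"
    using insert by (intro finsum_cong') (auto intro!: finsum_closed simp: Pi_iff)
  finally show ?case .
qed

text \<open>The terms that remove \<open>a\<close> before \<open>b\<close> and \<open>b\<close> before \<open>a\<close> cancel in the square of a boundary
  map. The diagonal is left out because antisymmetry alone makes its terms vanish only where \<open>2\<close> is
  not a zero divisor.\<close>

lemma (in abelian_monoid) finsum_antisymmetric:
  assumes "finite A" "\<And>a b. a \<in> A \<Longrightarrow> b \<in> A \<Longrightarrow> a \<noteq> b \<Longrightarrow> f a b \<in> carrier G"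
    and "\<And>a b. a \<in> A \<Longrightarrow> b \<in> A \<Longrightarrow> a \<noteq> b \<Longrightarrow> f a b \<oplus> f b a = \<zero>"
  shows "(\<Oplus>a\<in>A. \<Oplus>b\<in>A - {a}. f a b) = \<zero>"
  using assms
proof (induction A)
  case empty
  then show ?case by simp
next
  case (insert x A)
  have cl: "(\<Oplus>b\<in>A - {a}. f a b) \<in> carrier G" if "a \<in> A" for a
    using insert that by (intro finsum_closed) auto
  have cross: "f a x \<in> carrier G" "f x a \<in> carrier G" if "a \<in> A" for a
    using insert that by auto
  have row: "(\<Oplus>b\<in>insert x A - {a}. f a b) = f a x \<oplus> (\<Oplus>b\<in>A - {a}. f a b)" if "a \<in> A" for a
  proof -
    have "insert x A - {a} = insert x (A - {a})" using that insert by auto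
    then show ?thesis using that insert by (simp, subst finsum_insert) (auto simp: Pi_iff)
  qed
  have "(\<Oplus>a\<in>insert x A. \<Oplus>b\<in>insert x A - {a}. f a b) =
        (\<Oplus>b\<in>insert x A - {x}. f x b) \<oplus> (\<Oplus>a\<in>A. \<Oplus>b\<in>insert x A - {a}. f a b)"
    using insert by (intro finsum_insert) (auto intro!: finsum_closed)
  also have "insert x A - {x} = A" using insert by auto
  also have "(\<Oplus>a\<in>A. \<Oplus>b\<in>insert x A - {a}. f a b) = (\<Oplus>a\<in>A. f a x \<oplus> (\<Oplus>b\<in>A - {a}. f a b))"
  proof (rule finsum_cong')
    show "(\<lambda>a. f a x \<oplus> (\<Oplus>b\<in>A - {a}. f a b)) \<in> A \<rightarrow> carrier G"
      using insert cl by (intro Pi_I a_closed) auto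
  qed (simp_all add: row)
  also have "\<dots> = (\<Oplus>a\<in>A. f a x) \<oplus> (\<Oplus>a\<in>A. \<Oplus>b\<in>A - {a}. f a b)"
    using insert cl by (intro finsum_addf Pi_I) auto
  also have "(\<Oplus>a\<in>A. \<Oplus>b\<in>A - {a}. f a b) = \<zero>"
    using insert by (intro insert.IH) auto
  also have "(\<Oplus>b\<in>A. f x b) \<oplus> ((\<Oplus>a\<in>A. f a x) \<oplus> \<zero>) = (\<Oplus>a\<in>A. f x a \<oplus> f a x)"
    using insert.hyps cross by (subst finsum_addf) (auto simp: Pi_iff finsum_closed)
  also have "\<dots> = (\<Oplus>a\<in>A. \<zero>)"
    using insert by (intro finsum_cong') auto
  finally show ?case by simp
qed

lemma free_module_simps [simp]:
  "\<zero>\<^bsub>free_module R B\<^esub> = (\<lambda>b. \<zero>\<^bsub>R\<^esub>)"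
  "f \<oplus>\<^bsub>free_module R B\<^esub> g = (\<lambda>b. f b \<oplus>\<^bsub>R\<^esub> g b)"
  "a \<odot>\<^bsub>free_module R B\<^esub> f = (\<lambda>b. a \<otimes>\<^bsub>R\<^esub> f b)"
  by (simp_all add: free_module_def)

lemma (in cring) carrier_free_module:
  assumes "finite B"
  shows "carrier (free_module R B) = {f. (\<forall>b. f b \<in> carrier R) \<and> (\<forall>b. b \<notin> B \<longrightarrow> f b = \<zero>)}"
proof -
  have "finite {b. f b \<noteq> \<zero>}" if "\<forall>b. b \<notin> B \<longrightarrow> f b = \<zero>" for f
    by (rule finite_subset[OF _ assms]) (use that in auto)
  then show ?thesis
    by (auto simp: free_module_def)
qed

lemma (in cring) finsum_free_module:
  assumes "finite A" "finite B" "F \<in> A \<rightarrow> carrier (free_module R B)"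
  shows "(\<Oplus>\<^bsub>free_module R B\<^esub>a\<in>A. F a) b = (\<Oplus>a\<in>A. F a b)"
  using assms(1,3)
proof (induction A)
  case empty
  interpret M: module R "free_module R B"
    by (rule module_free_module[OF cring_axioms])
  show ?case by (simp only: M.finsum_empty finsum_empty free_module_simps)
next
  case (insert x A)
  interpret M: module R "free_module R B"
    by (rule module_free_module[OF cring_axioms])
  have "F a b \<in> carrier R" if "a \<in> insert x A" for a
    using insert.prems that assms(2) by (auto simp: carrier_free_module)
  then show ?case
    using insert by (simp add: M.finsum_insert Pi_iff)
qed

text \<open>Both differentials are sums over pairs of a face \<open>\<sigma>\<close> and a vertex \<open>j\<close> that lead to a basis
  vector \<open>t j \<sigma>\<close>. At \<open>\<tau>\<close> only the pairs with \<open>t j \<sigma> = \<tau>\<close> contribute, and for each \<open>j\<close> the face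
  \<open>\<sigma>\<close> is then determined as \<open>u j\<close>.\<close>

lemma (in cring) finsum_incidence:
  assumes "finite S" "finite W" "I \<subseteq> W"
    and J: "\<And>\<sigma>. \<sigma> \<in> S \<Longrightarrow> J \<sigma> \<subseteq> W"
    and f: "\<And>\<sigma>. f \<sigma> \<in> carrier R" and c: "\<And>j \<sigma>. c j \<sigma> \<in> carrier R"
    and t: "\<And>j \<sigma>. \<sigma> \<in> S \<Longrightarrow> j \<in> J \<sigma> \<Longrightarrow> t j \<sigma> = \<tau> \<longleftrightarrow> j \<in> I \<and> \<sigma> = u j"
    and u: "\<And>j. j \<in> I \<Longrightarrow> u j \<in> S \<Longrightarrow> j \<in> J (u j)"
    and f0: "\<And>j. j \<in> I \<Longrightarrow> u j \<notin> S \<Longrightarrow> f (u j) = \<zero>"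
  shows "(\<Oplus>\<sigma>\<in>S. f \<sigma> \<otimes> (\<Oplus>j\<in>J \<sigma>. c j \<sigma> \<otimes> basis_vec R (t j \<sigma>) \<tau>)) = (\<Oplus>j\<in>I. c j (u j) \<otimes> f (u j))"
proof -
  \<comment> \<open>The summand extended by zero to all of \<open>S \<times> W\<close>, so that the two sums can be exchanged.\<close>
  define g where "g j \<sigma> = (if j \<in> I \<and> \<sigma> = u j then c j (u j) \<otimes> f (u j) else \<zero>)" for j \<sigma>
  have g: "g j \<sigma> \<in> carrier R" for j \<sigma>
    by (simp add: g_def f c)
  have "f \<sigma> \<otimes> (\<Oplus>j\<in>J \<sigma>. c j \<sigma> \<otimes> basis_vec R (t j \<sigma>) \<tau>) = (\<Oplus>j\<in>W. g j \<sigma>)" if \<sigma>: "\<sigma> \<in> S" for \<sigma>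
  proof -
    have fin: "finite (J \<sigma>)"
      using J[OF \<sigma>] \<open>finite W\<close> by (rule finite_subset)
    have "f \<sigma> \<otimes> (\<Oplus>j\<in>J \<sigma>. c j \<sigma> \<otimes> basis_vec R (t j \<sigma>) \<tau>) =
        (\<Oplus>j\<in>J \<sigma>. f \<sigma> \<otimes> (c j \<sigma> \<otimes> basis_vec R (t j \<sigma>) \<tau>))"
      using fin by (intro finsum_rdistr) (auto simp: f c basis_vec_def)
    also have "\<dots> = (\<Oplus>j\<in>W. g j \<sigma>)"
    proof (rule add.finprod_mono_neutral_cong_left)
      show "g j \<sigma> = \<zero>" if "j \<in> W - J \<sigma>" for j
        using that u \<sigma> by (auto simp: g_def)
      show "f \<sigma> \<otimes> (c j \<sigma> \<otimes> basis_vec R (t j \<sigma>) \<tau>) = g j \<sigma>" if "j \<in> J \<sigma>" for j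
        using t[OF \<sigma> that] by (auto simp: g_def basis_vec_def f c m_comm eq_commute[of \<tau>])
    qed (use J[OF \<sigma>] \<open>finite W\<close> g in auto)
    finally show ?thesis .
  qed
  then have "(\<Oplus>\<sigma>\<in>S. f \<sigma> \<otimes> (\<Oplus>j\<in>J \<sigma>. c j \<sigma> \<otimes> basis_vec R (t j \<sigma>) \<tau>)) =
      (\<Oplus>\<sigma>\<in>S. \<Oplus>j\<in>W. g j \<sigma>)"
    by (intro finsum_cong') (auto intro!: finsum_closed g)
  also have "\<dots> = (\<Oplus>j\<in>W. \<Oplus>\<sigma>\<in>S. g j \<sigma>)"
    using assms(1,2) g by (intro finsum_swap)
  also have "\<dots> = (\<Oplus>j\<in>I. c j (u j) \<otimes> f (u j))"
  proof (rule add.finprod_mono_neutral_cong_right)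
    show "(\<Oplus>\<sigma>\<in>S. g j \<sigma>) = \<zero>" if "j \<in> W - I" for j
      using that by (simp add: g_def)
    show "(\<Oplus>\<sigma>\<in>S. g j \<sigma>) = c j (u j) \<otimes> f (u j)" if "j \<in> I" for j
    proof (cases "u j \<in> S")
      case True
      have "(\<Oplus>\<sigma>\<in>S. g j \<sigma>) = (\<Oplus>\<sigma>\<in>S. if u j = \<sigma> then c j \<sigma> \<otimes> f \<sigma> else \<zero>)"
        using that by (intro finsum_cong') (auto simp: g_def f c)
      also have "\<dots> = c j (u j) \<otimes> f (u j)"
        using True \<open>finite S\<close> by (intro finsum_singleton) (auto simp: f c)
      finally show ?thesis .
    next
      case False
      then have "(\<Oplus>\<sigma>\<in>S. g j \<sigma>) = (\<Oplus>\<sigma>\<in>S. \<zero>)"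
        by (intro finsum_cong') (auto simp: g_def)
      then show ?thesis
        using f0[OF that False] by (simp add: c)
    qed
  qed (use assms g in \<open>auto intro!: finsum_closed\<close>)
  finally show ?thesis .
qed

section \<open>Signs\<close>

lemma (in cring) neg_one_power_eq:
  "(\<ominus> \<one>) [^] (n::nat) = (if even n then \<one> else \<ominus> \<one>)"
  by (induction n) (auto simp: r_minus)

locale ordered_vertices = cring R for R (structure) +
  fixes V :: "'v set" and \<nu> :: "'v \<Rightarrow> nat"
  assumes finite_V: "finite V" and inj_\<nu>: "inj_on \<nu> V"
begin

abbreviation sgn where "sgn \<equiv> face_sgn R \<nu>"

text \<open>The exponent of the sign of \<open>j\<close> in \<open>\<sigma>\<close>, read off without the truncated subtraction in
  \<open>face_sgn\<close>. Unlike that exponent it is meaningful also for \<open>j \<notin> \<sigma>\<close>, and inserting \<open>j\<close> itself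
  does not change it.\<close>

definition rank :: "'v \<Rightarrow> 'v set \<Rightarrow> nat" where
  "rank j \<sigma> = card {k \<in> \<sigma>. \<nu> k < \<nu> j}"

lemma sgn_closed [simp]: "sgn j \<sigma> \<in> carrier R"
  by (simp add: face_sgn_def)

lemma sgn_eq_rank:
  assumes "\<sigma> \<subseteq> V" "j \<in> \<sigma>"
  shows "sgn j \<sigma> = (\<ominus> \<one>) [^] rank j \<sigma>"
proof -
  have "{k \<in> \<sigma>. \<nu> k \<le> \<nu> j} = insert j {k \<in> \<sigma>. \<nu> k < \<nu> j}"
    using assms inj_\<nu> by (auto simp: inj_on_def le_less subset_iff)
  moreover have "finite \<sigma>" using assms finite_V by (auto intro: finite_subset)
  ultimately show ?thesis
    by (simp add: face_sgn_def rank_def)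
qed

lemma rank_insert:
  assumes "finite \<sigma>" "l \<notin> \<sigma>"
  shows "rank j (insert l \<sigma>) = rank j \<sigma> + (if \<nu> l < \<nu> j then 1 else 0)"
proof -
  have "{k \<in> insert l \<sigma>. \<nu> k < \<nu> j} =
      (if \<nu> l < \<nu> j then insert l {k \<in> \<sigma>. \<nu> k < \<nu> j} else {k \<in> \<sigma>. \<nu> k < \<nu> j})"
    by auto
  then show ?thesis
    using assms by (simp add: rank_def)
qed

lemma sgn_insert:
  assumes "\<tau> \<subseteq> V" "j \<in> V - \<tau>"
  shows "sgn j (insert j \<tau>) = (\<ominus> \<one>) [^] rank j \<tau>"
  using assms finite_subset[OF _ finite_V] by (simp add: sgn_eq_rank rank_insert)

lemma sgn_insert_insert:
  assumes "\<tau> \<subseteq> V" "j \<in> V - \<tau>" "l \<in> V - \<tau>" "j \<noteq> l"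
  shows "sgn j (insert j (insert l \<tau>)) = (\<ominus> \<one>) [^] (rank j \<tau> + (if \<nu> l < \<nu> j then 1 else 0))"
proof -
  have "finite \<tau>" using assms finite_V by (auto intro: finite_subset)
  then show ?thesis
    using assms by (simp add: sgn_eq_rank rank_insert)
qed

text \<open>Inserting \<open>l\<close> shifts the rank of \<open>j\<close> exactly if \<open>l\<close> precedes \<open>j\<close>, and of two distinct
  vertices exactly one precedes the other.\<close>

lemma sgn_anticommute:
  assumes "\<tau> \<subseteq> V" "j \<in> V - \<tau>" "l \<in> V - \<tau>" "j \<noteq> l"
  shows "sgn j (insert j \<tau>) \<otimes> sgn l (insert l (insert j \<tau>)) =
      \<ominus> (sgn l (insert l \<tau>) \<otimes> sgn j (insert j (insert l \<tau>)))"
    and "sgn j (insert j (insert l \<tau>)) \<otimes> sgn l (insert l (insert j \<tau>)) =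
      \<ominus> (sgn l (insert l \<tau>) \<otimes> sgn j (insert j \<tau>))"
proof -
  have "\<nu> j < \<nu> l \<or> \<nu> l < \<nu> j"
    using assms inj_\<nu> by (auto simp: inj_on_def neq_iff[symmetric])
  moreover have "sgn j (insert j \<tau>) = (\<ominus> \<one>) [^] rank j \<tau>" "sgn l (insert l \<tau>) = (\<ominus> \<one>) [^] rank l \<tau>"
    using assms by (simp_all add: sgn_insert)
  moreover note sgn_insert_insert[OF assms] sgn_insert_insert[OF assms(1,3,2) assms(4)[symmetric]]
  ultimately show "sgn j (insert j \<tau>) \<otimes> sgn l (insert l (insert j \<tau>)) =
      \<ominus> (sgn l (insert l \<tau>) \<otimes> sgn j (insert j (insert l \<tau>)))"
    "sgn j (insert j (insert l \<tau>)) \<otimes> sgn l (insert l (insert j \<tau>)) =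
      \<ominus> (sgn l (insert l \<tau>) \<otimes> sgn j (insert j \<tau>))"
    by (auto simp: neg_one_power_eq l_minus r_minus)
qed

lemma sgn_sgn:
  assumes "\<tau> \<subseteq> V" "j \<in> V - \<tau>"
  shows "sgn j (insert j \<tau>) \<otimes> sgn j (insert j \<tau>) = \<one>"
  using assms by (simp add: sgn_insert neg_one_power_eq l_minus r_minus)

text \<open>The sign that makes complementation a map of complexes: passing from \<open>\<tau> - {j}\<close> to \<open>\<tau>\<close> multiplies it
  by the sign of exponent \<open>rank j V\<close>, and that exponent splits into the ranks of \<open>j\<close> in \<open>\<tau>\<close> and in
  the complement of \<open>\<tau>\<close>.\<close>

definition dual_sgn where
  "dual_sgn \<tau> = (\<ominus> \<one>) [^] (\<Sum>k\<in>\<tau>. rank k V)"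

lemma dual_sgn_closed [simp]: "dual_sgn \<tau> \<in> carrier R"
  by (simp add: dual_sgn_def)

lemma dual_sgn_dual_sgn: "dual_sgn \<tau> \<otimes> dual_sgn \<tau> = \<one>"
  by (simp add: dual_sgn_def neg_one_power_eq l_minus r_minus)

lemma dual_sgn_remove:
  assumes "\<tau> \<subseteq> V" "j \<in> \<tau>"
  shows "sgn j \<tau> \<otimes> dual_sgn (\<tau> - {j}) = dual_sgn \<tau> \<otimes> sgn j (insert j (V - \<tau>))"
proof -
  have fin: "finite \<tau>" using assms finite_V by (auto intro: finite_subset)
  have "{k \<in> V. \<nu> k < \<nu> j} = {k \<in> \<tau>. \<nu> k < \<nu> j} \<union> {k \<in> V - \<tau>. \<nu> k < \<nu> j}"
    using assms by auto
  then have "rank j V = rank j \<tau> + rank j (V - \<tau>)"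
    using fin finite_V unfolding rank_def by (simp, subst card_Un_disjoint) auto
  moreover have "(\<Sum>k\<in>\<tau>. rank k V) = rank j V + (\<Sum>k\<in>\<tau> - {j}. rank k V)"
    by (rule sum.remove[OF fin assms(2)])
  ultimately show ?thesis
    using assms by (auto simp: dual_sgn_def sgn_eq_rank[of \<tau>] sgn_insert neg_one_power_eq l_minus r_minus)
qed

section \<open>Chains on the full simplex\<close>

text \<open>The boundary map of the full simplex on \<open>V\<close>, in all degrees at once and in coordinates: the coefficient
  at \<open>\<tau>\<close> collects the faces \<open>\<tau> \<union> {j}\<close> above it.\<close>

definition del where
  "del f = (\<lambda>\<tau>. if \<tau> \<subseteq> V then \<Oplus>j\<in>V - \<tau>. sgn j (insert j \<tau>) \<otimes> f (insert j \<tau>) else \<zero>)"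

text \<open>On basis vectors this is \<open>\<sigma> \<mapsto> \<plusminus> (\<sigma> \<union> {v})\<close> for \<open>v \<notin> \<sigma>\<close>, and \<open>\<sigma> \<mapsto> 0\<close> otherwise.\<close>

definition cone where
  "cone v f = (\<lambda>\<sigma>. if v \<in> \<sigma> then sgn v \<sigma> \<otimes> f (\<sigma> - {v}) else \<zero>)"

definition restrict_chain where
  "restrict_chain A f = (\<lambda>\<sigma>. if \<sigma> \<in> A then f \<sigma> else \<zero>)"

definition complement_chain where
  "complement_chain f = (\<lambda>\<tau>. if \<tau> \<subseteq> V then dual_sgn \<tau> \<otimes> f (V - \<tau>) else \<zero>)"

lemma finite_faces: "A \<subseteq> Pow V \<Longrightarrow> finite A"
  using finite_V by (metis finite_Pow_iff finite_subset)

lemma mem_chains: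
  assumes "A \<subseteq> Pow V"
  shows "f \<in> carrier (free_module R A) \<longleftrightarrow> (\<forall>\<sigma>. f \<sigma> \<in> carrier R) \<and> (\<forall>\<sigma>. \<sigma> \<notin> A \<longrightarrow> f \<sigma> = \<zero>)"
  using finite_faces[OF assms] by (simp add: carrier_free_module)

lemma uminus_chain:
  assumes "f \<in> carrier (free_module R (Pow V))"
  shows "\<ominus>\<^bsub>free_module R (Pow V)\<^esub> f = (\<lambda>\<sigma>. \<ominus> f \<sigma>)"
proof -
  interpret G: module R "free_module R (Pow V)"
    by (rule module_free_module[OF cring_axioms])
  show ?thesis
    using assms by (intro G.minus_equality) (simp_all add: mem_chains l_neg)
qed

lemma linear_map_del:
  assumes "A \<subseteq> Pow V" "B \<subseteq> Pow V"
    and "\<And>j \<tau>. \<tau> \<subseteq> V \<Longrightarrow> j \<in> V - \<tau> \<Longrightarrow> insert j \<tau> \<in> A \<Longrightarrow> \<tau> \<in> B"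
  shows "linear_map R (free_module R A) (free_module R B) del"
proof (rule linear_mapI)
  fix f assume f: "f \<in> carrier (free_module R A)"
  have "(\<Oplus>j\<in>V - \<tau>. sgn j (insert j \<tau>) \<otimes> f (insert j \<tau>)) = (\<Oplus>j\<in>V - \<tau>. \<zero>)"
    if "\<tau> \<subseteq> V" "\<tau> \<notin> B" for \<tau>
  proof (intro finsum_cong')
    fix j assume "j \<in> V - \<tau>"
    then have "insert j \<tau> \<notin> A"
      using that assms(3) by blast
    then show "sgn j (insert j \<tau>) \<otimes> f (insert j \<tau>) = \<zero>"
      using f by (simp add: mem_chains[OF assms(1)])
  qed auto
  then show "del f \<in> carrier (free_module R B)"
    using f by (auto simp: mem_chains[OF assms(1)] mem_chains[OF assms(2)] del_def
        intro!: finsum_closed)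
next
  fix f g assume "f \<in> carrier (free_module R A)" "g \<in> carrier (free_module R A)"
  then show "del (f \<oplus>\<^bsub>free_module R A\<^esub> g) = del f \<oplus>\<^bsub>free_module R B\<^esub> del g"
    by (auto simp: mem_chains[OF assms(1)] del_def r_distr finsum_addf Pi_iff fun_eq_iff)
next
  fix a f assume "a \<in> carrier R" "f \<in> carrier (free_module R A)"
  then show "del (a \<odot>\<^bsub>free_module R A\<^esub> f) = a \<odot>\<^bsub>free_module R B\<^esub> del f"
    using finite_V
    by (auto simp: mem_chains[OF assms(1)] del_def m_lcomm finsum_rdistr Pi_iff fun_eq_iff)
qed

lemma linear_map_cone:
  assumes "A \<subseteq> Pow V" "B \<subseteq> Pow V" "\<And>\<sigma>. v \<in> \<sigma> \<Longrightarrow> \<sigma> - {v} \<in> A \<Longrightarrow> \<sigma> \<in> B"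
  shows "linear_map R (free_module R A) (free_module R B) (cone v)"
proof -
  have "\<sigma> - {v} \<notin> A" if "v \<in> \<sigma>" "\<sigma> \<notin> B" for \<sigma>
    using that assms(3) by blast
  then show ?thesis
    by (intro linear_mapI) (auto simp: mem_chains[OF assms(1)] mem_chains[OF assms(2)] cone_def
        fun_eq_iff r_distr m_lcomm)
qed

lemma linear_map_restrict_chain:
  assumes "A \<subseteq> Pow V" "B \<subseteq> Pow V" "A \<inter> C \<subseteq> B"
  shows "linear_map R (free_module R A) (free_module R B) (restrict_chain C)"
  by (rule linear_mapI)
    (use assms(3) in \<open>auto simp: mem_chains[OF assms(1)] mem_chains[OF assms(2)] restrict_chain_def
        fun_eq_iff\<close>)

lemma linear_map_complement_chain:
  assumes "A \<subseteq> Pow V" "B \<subseteq> Pow V" "\<And>\<tau>. \<tau> \<subseteq> V \<Longrightarrow> V - \<tau> \<in> A \<Longrightarrow> \<tau> \<in> B"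
  shows "linear_map R (free_module R A) (free_module R B) complement_chain"
proof -
  have "V - \<tau> \<notin> A" if "\<tau> \<subseteq> V" "\<tau> \<notin> B" for \<tau>
    using that assms(3) by blast
  then show ?thesis
    by (intro linear_mapI) (auto simp: mem_chains[OF assms(1)] mem_chains[OF assms(2)]
        complement_chain_def fun_eq_iff r_distr m_lcomm)
qed

lemma del_del:
  assumes f: "f \<in> carrier (free_module R (Pow V))"
  shows "del (del f) = (\<lambda>\<tau>. \<zero>)"
proof
  fix \<tau>
  show "del (del f) \<tau> = \<zero>"
  proof (cases "\<tau> \<subseteq> V")
    case True
    have fc: "f \<sigma> \<in> carrier R" for \<sigma>
      using f by (simp add: mem_chains)
    define a where "a j l = sgn j (insert j \<tau>) \<otimes>
        (sgn l (insert l (insert j \<tau>)) \<otimes> f (insert l (insert j \<tau>)))" for j l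
    have "del (del f) \<tau> = (\<Oplus>j\<in>V - \<tau>. \<Oplus>l\<in>V - \<tau> - {j}. a j l)"
      using True finite_V fc
      by (auto simp: del_def a_def finsum_rdistr Pi_iff Diff_insert2[symmetric] Diff_insert[symmetric]
          intro!: finsum_cong' finsum_closed)
    also have "\<dots> = \<zero>"
    proof (rule finsum_antisymmetric)
      fix j l assume jl: "j \<in> V - \<tau>" "l \<in> V - \<tau>" "j \<noteq> l"
      show "a j l \<oplus> a l j = \<zero>"
        using sgn_anticommute(1)[OF True jl] fc
        by (simp add: a_def m_assoc[symmetric] insert_commute[of l j] l_minus l_neg)
    qed (use finite_V fc in \<open>auto simp: a_def\<close>)
    finally show ?thesis .
  qed (simp add: del_def)
qed

text \<open>The full simplex is a cone with apex \<open>v\<close>, hence contractible. At a face without \<open>v\<close> only the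
  term that inserts \<open>v\<close> survives. At a face with \<open>v\<close>, that term comes from \<open>cone v (del f)\<close>, and all
  others occur in both summands with opposite signs.\<close>

lemma del_cone:
  assumes f: "f \<in> carrier (free_module R (Pow V))" and v: "v \<in> V"
  shows "del (cone v f) \<tau> \<oplus> cone v (del f) \<tau> = f \<tau>"
proof -
  have fc: "f \<sigma> \<in> carrier R" for \<sigma>
    using f by (simp add: mem_chains)
  consider "\<not> \<tau> \<subseteq> V" | "\<tau> \<subseteq> V" "v \<notin> \<tau>" | "\<tau> \<subseteq> V" "v \<in> \<tau>" by blast
  then show ?thesis
  proof cases
    case 1
    then show ?thesis
      using f v by (auto simp: mem_chains del_def cone_def)
  next
    case 2
    have "(\<Oplus>j\<in>V - \<tau>. sgn j (insert j \<tau>) \<otimes> cone v f (insert j \<tau>)) =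
        (\<Oplus>j\<in>V - \<tau>. if v = j then f \<tau> else \<zero>)"
    proof (rule finsum_cong')
      fix j assume j: "j \<in> V - \<tau>"
      have "sgn v (insert v \<tau>) \<otimes> (sgn v (insert v \<tau>) \<otimes> f \<tau>) = f \<tau>"
        using 2 v fc by (simp add: m_assoc[symmetric] sgn_sgn)
      then show "sgn j (insert j \<tau>) \<otimes> cone v f (insert j \<tau>) = (if v = j then f \<tau> else \<zero>)"
        using 2 v by (auto simp: cone_def)
    qed (use fc in auto)
    also have "\<dots> = f \<tau>"
      using 2 v finite_V fc by (intro finsum_singleton) auto
    finally show ?thesis
      using 2 fc by (simp add: del_def cone_def)
  next
    case 3
    \<comment> \<open>The signs are compared over the base face \<open>\<rho>\<close>, which contains neither \<open>v\<close> nor \<open>j\<close>.\<close>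
    define \<rho> where "\<rho> = \<tau> - {v}"
    have \<tau>: "\<tau> = insert v \<rho>" "v \<notin> \<rho>" "\<rho> \<subseteq> V"
      using 3 by (auto simp: \<rho>_def)
    have V: "V - \<rho> = insert v (V - \<tau>)"
      using \<tau> v by auto
    have r: "\<rho> - {v} = \<rho>" "insert v \<rho> - {v} = \<rho>" using \<tau> by auto
    let ?g = "\<lambda>j. sgn v \<tau> \<otimes> (sgn j (insert j \<rho>) \<otimes> f (insert j \<rho>))"
    have "del f \<rho> = sgn v \<tau> \<otimes> f \<tau> \<oplus> (\<Oplus>j\<in>V - \<tau>. sgn j (insert j \<rho>) \<otimes> f (insert j \<rho>))"
      using \<tau> v finite_V fc unfolding del_def V by (subst finsum_insert) auto
    then have "cone v (del f) \<tau> = f \<tau> \<oplus> (\<Oplus>j\<in>V - \<tau>. ?g j)"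
      using \<tau> v finite_V fc sgn_sgn[of \<rho> v]
      by (simp add: cone_def r r_distr finsum_rdistr Pi_iff m_assoc[symmetric])
    moreover have "del (cone v f) \<tau> = (\<Oplus>j\<in>V - \<tau>. \<ominus> ?g j)"
      unfolding del_def
    proof (simp add: 3, rule finsum_cong')
      fix j assume "j \<in> V - \<tau>"
      then have j: "j \<in> V - \<rho>" "v \<in> V - \<rho>" "j \<noteq> v" "insert j \<tau> - {v} = insert j \<rho>" "v \<in> insert j \<tau>"
        using \<tau> v by auto
      have "sgn j (insert j \<tau>) \<otimes> sgn v (insert j \<tau>) = \<ominus> (sgn v \<tau> \<otimes> sgn j (insert j \<rho>))"
        using sgn_anticommute(2)[OF \<tau>(3) j(1-3)] by (simp add: \<tau>(1) insert_commute[of v j])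
      then show "sgn j (insert j \<tau>) \<otimes> cone v f (insert j \<tau>) = \<ominus> ?g j"
        using fc j(4,5) by (simp add: cone_def m_assoc[symmetric] l_minus)
    qed (use fc in auto)
    moreover have "(\<Oplus>j\<in>V - \<tau>. \<ominus> ?g j) \<oplus> (\<Oplus>j\<in>V - \<tau>. ?g j) = \<zero>"
      using fc by (subst finsum_addf[symmetric]) (auto simp: l_neg)
    ultimately show ?thesis
      using fc by (simp add: a_lcomm finsum_closed)
  qed
qed

section \<open>Boundary and coboundary\<close>

lemma faces_subset: "X \<subseteq> Pow V \<Longrightarrow> faces X i \<subseteq> Pow V"
  by (auto simp: faces_def)

lemma basis_vec_mem_chains:
  assumes "A \<subseteq> Pow V" "\<sigma> \<in> A"
  shows "basis_vec R \<sigma> \<in> carrier (free_module R A)"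
  using assms by (auto simp: mem_chains basis_vec_def)

text \<open>The defining sums of both differentials are formed in a module of chains on \<open>A\<close>; they may be evaluated
  coordinatewise because every basis vector involved belongs to \<open>A\<close>.\<close>

lemma finsum_basis_vec:
  assumes "A \<subseteq> Pow V" "finite S" and f: "\<And>\<sigma>. f \<sigma> \<in> carrier R" and c: "\<And>j \<sigma>. c j \<sigma> \<in> carrier R"
    and J: "\<And>\<sigma>. \<sigma> \<in> S \<Longrightarrow> finite (J \<sigma>)"
    and t: "\<And>\<sigma> j. \<sigma> \<in> S \<Longrightarrow> j \<in> J \<sigma> \<Longrightarrow> t j \<sigma> \<in> A"
  defines "C \<equiv> free_module R A"
  defines "g \<equiv> \<Oplus>\<^bsub>C\<^esub>\<sigma>\<in>S. f \<sigma> \<odot>\<^bsub>C\<^esub> (\<Oplus>\<^bsub>C\<^esub>j\<in>J \<sigma>. c j \<sigma> \<odot>\<^bsub>C\<^esub> basis_vec R (t j \<sigma>))"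
  shows "g \<in> carrier C" and
    "g \<tau> = (\<Oplus>\<sigma>\<in>S. f \<sigma> \<otimes> (\<Oplus>j\<in>J \<sigma>. c j \<sigma> \<otimes> basis_vec R (t j \<sigma>) \<tau>))"
proof -
  interpret C: module R C
    unfolding C_def by (rule module_free_module[OF cring_axioms])
  note fin = finite_faces[OF assms(1)]
  have in1: "c j \<sigma> \<odot>\<^bsub>C\<^esub> basis_vec R (t j \<sigma>) \<in> carrier C" if "\<sigma> \<in> S" "j \<in> J \<sigma>" for j \<sigma>
    using basis_vec_mem_chains[OF assms(1) t[OF that]] c by (intro C.smult_closed) (auto simp: C_def)
  then have "(\<Oplus>\<^bsub>C\<^esub>j\<in>J \<sigma>. c j \<sigma> \<odot>\<^bsub>C\<^esub> basis_vec R (t j \<sigma>)) \<in> carrier C"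
    if "\<sigma> \<in> S" for \<sigma>
    using that by (intro C.finsum_closed Pi_I)
  then have in2: "f \<sigma> \<odot>\<^bsub>C\<^esub> (\<Oplus>\<^bsub>C\<^esub>j\<in>J \<sigma>. c j \<sigma> \<odot>\<^bsub>C\<^esub> basis_vec R (t j \<sigma>)) \<in> carrier C"
    if "\<sigma> \<in> S" for \<sigma>
    using that f by (intro C.smult_closed)
  then show "g \<in> carrier C"
    unfolding g_def by (intro C.finsum_closed Pi_I)
  have "g \<tau> = (\<Oplus>\<sigma>\<in>S. (f \<sigma> \<odot>\<^bsub>C\<^esub> (\<Oplus>\<^bsub>C\<^esub>j\<in>J \<sigma>. c j \<sigma> \<odot>\<^bsub>C\<^esub> basis_vec R (t j \<sigma>))) \<tau>)"
    unfolding g_def using in2 unfolding C_def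
    by (intro finsum_free_module[OF \<open>finite S\<close> fin] Pi_I)
  also have "\<dots> = (\<Oplus>\<sigma>\<in>S. f \<sigma> \<otimes> (\<Oplus>j\<in>J \<sigma>. c j \<sigma> \<otimes> basis_vec R (t j \<sigma>) \<tau>))"
  proof (rule finsum_cong')
    fix \<sigma> assume \<sigma>: "\<sigma> \<in> S"
    have "(\<Oplus>\<^bsub>C\<^esub>j\<in>J \<sigma>. c j \<sigma> \<odot>\<^bsub>C\<^esub> basis_vec R (t j \<sigma>)) \<tau> =
        (\<Oplus>j\<in>J \<sigma>. (c j \<sigma> \<odot>\<^bsub>C\<^esub> basis_vec R (t j \<sigma>)) \<tau>)"
      using in1[OF \<sigma>] unfolding C_def by (intro finsum_free_module[OF J[OF \<sigma>] fin] Pi_I)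
    then show "(f \<sigma> \<odot>\<^bsub>C\<^esub> (\<Oplus>\<^bsub>C\<^esub>j\<in>J \<sigma>. c j \<sigma> \<odot>\<^bsub>C\<^esub> basis_vec R (t j \<sigma>))) \<tau> =
        f \<sigma> \<otimes> (\<Oplus>j\<in>J \<sigma>. c j \<sigma> \<otimes> basis_vec R (t j \<sigma>) \<tau>)"
      by (simp add: C_def)
  qed (use f c in \<open>auto simp: basis_vec_def intro!: m_closed finsum_closed\<close>)
  finally show "g \<tau> = (\<Oplus>\<sigma>\<in>S. f \<sigma> \<otimes> (\<Oplus>j\<in>J \<sigma>. c j \<sigma> \<otimes> basis_vec R (t j \<sigma>) \<tau>))" .
qed

lemma face_dim_remove: "\<sigma> \<subseteq> V \<Longrightarrow> j \<in> \<sigma> \<Longrightarrow> face_dim (\<sigma> - {j}) = face_dim \<sigma> - 1"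
  using finite_subset[OF _ finite_V, of \<sigma>] card_Suc_Diff1[of \<sigma> j] by (simp add: face_dim_def)

lemma face_dim_insert: "\<sigma> \<subseteq> V \<Longrightarrow> j \<notin> \<sigma> \<Longrightarrow> face_dim (insert j \<sigma>) = face_dim \<sigma> + 1"
  using finite_subset[OF _ finite_V, of \<sigma>] by (simp add: face_dim_def)

lemma face_dim_complement: "\<sigma> \<subseteq> V \<Longrightarrow> face_dim (V - \<sigma>) = int (card V) - face_dim \<sigma> - 2"
  using card_mono[OF finite_V, of \<sigma>] finite_subset[OF _ finite_V, of \<sigma>]
  by (simp add: face_dim_def card_Diff_subset of_nat_diff)

text \<open>The boundary map of a complex is the restriction of the one of the full simplex, because faces of faces
  of \<open>X\<close> belong to \<open>X\<close>.\<close>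

lemma boundary_eq_del:
  assumes X: "simplicial_complex_on V X" and f: "f \<in> carrier (chain_module R X i)"
  shows "boundary R \<nu> X i f = del f"
proof
  fix \<tau>
  have XV: "X \<subseteq> Pow V" and down: "\<And>\<sigma> \<tau>. \<sigma> \<in> X \<Longrightarrow> \<tau> \<subseteq> \<sigma> \<Longrightarrow> \<tau> \<in> X"
    using X by (auto simp: simplicial_complex_on_def)
  note sub = faces_subset[OF XV]
  have fc: "f \<sigma> \<in> carrier R" for \<sigma>
    using f by (simp add: chain_module_def mem_chains[OF sub])
  have f0: "f \<sigma> = \<zero>" if "\<sigma> \<notin> faces X i" for \<sigma>
    using f that by (simp add: chain_module_def mem_chains[OF sub])
  have closed: "\<sigma> - {j} \<in> faces X (i - 1)" if "\<sigma> \<in> faces X i" "j \<in> \<sigma>" for \<sigma> j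
    using that XV down[of \<sigma> "\<sigma> - {j}"] by (auto simp: faces_def face_dim_remove)
  have fin: "finite \<sigma>" if "\<sigma> \<in> faces X i" for \<sigma>
    using that sub finite_V by (meson PowD finite_subset subsetD)
  note basis = finsum_basis_vec[where A = "faces X (i - 1)" and S = "faces X i" and f = f
      and c = "\<lambda>j \<sigma>. sgn j \<sigma>" and J = "\<lambda>\<sigma>. \<sigma>" and t = "\<lambda>j \<sigma>. \<sigma> - {j}",
      OF sub finite_faces[OF sub] fc sgn_closed fin closed]
  show "boundary R \<nu> X i f \<tau> = del f \<tau>"
  proof (cases "\<tau> \<subseteq> V")
    case False
    then have "boundary R \<nu> X i f \<tau> = \<zero>"
      using basis(1) sub[of "i - 1"]
      by (auto simp: boundary_def Let_def chain_module_def mem_chains[OF sub] simp del: free_module_simps)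
    then show ?thesis
      using False by (simp add: del_def)
  next
    case True
    have "boundary R \<nu> X i f \<tau> =
        (\<Oplus>\<sigma>\<in>faces X i. f \<sigma> \<otimes> (\<Oplus>j\<in>\<sigma>. sgn j \<sigma> \<otimes> basis_vec R (\<sigma> - {j}) \<tau>))"
      using basis(2)[of \<tau>] by (simp add: boundary_def Let_def chain_module_def del: free_module_simps)
    also have "\<dots> = (\<Oplus>j\<in>V - \<tau>. sgn j (insert j \<tau>) \<otimes> f (insert j \<tau>))"
      using sub f0 fc finite_V
      by (intro finsum_incidence[where W = V] finite_faces[OF sub]) auto
    finally show ?thesis
      using True by (simp add: del_def)
  qed
qed

lemma linear_map_boundary:
  assumes "simplicial_complex_on V X"
  shows "linear_map R (chain_module R X i) (chain_module R X (i - 1)) (boundary R \<nu> X i)"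
proof (rule linear_map_cong[where h = del])
  have XV: "X \<subseteq> Pow V" and down: "\<And>\<sigma> \<tau>. \<sigma> \<in> X \<Longrightarrow> \<tau> \<subseteq> \<sigma> \<Longrightarrow> \<tau> \<in> X"
    using assms by (auto simp: simplicial_complex_on_def)
  show "linear_map R (chain_module R X i) (chain_module R X (i - 1)) del"
    unfolding chain_module_def
  proof (rule linear_map_del)
    fix j \<tau> assume "\<tau> \<subseteq> V" "j \<in> V - \<tau>" "insert j \<tau> \<in> faces X i"
    then show "\<tau> \<in> faces X (i - 1)"
      using down[of "insert j \<tau>" \<tau>] by (auto simp: faces_def face_dim_insert)
  qed (simp_all add: faces_subset[OF XV])
qed (simp_all add: boundary_eq_del[OF assms] chain_module_def module_free_module[OF cring_axioms])

lemma coboundary_apply: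
  assumes Y: "Y \<subseteq> Pow V" and g: "g \<in> carrier (chain_module R Y (i - 1))"
  shows "coboundary R \<nu> Y i g \<tau> =
    (if \<tau> \<in> faces Y i then \<Oplus>j\<in>\<tau>. sgn j \<tau> \<otimes> g (\<tau> - {j}) else \<zero>)"
proof -
  note sub = faces_subset[OF Y]
  define J where "J \<sigma> = {j. j \<notin> \<sigma> \<and> insert j \<sigma> \<in> Y}" for \<sigma>
  have gc: "g \<sigma> \<in> carrier R" for \<sigma>
    using g by (simp add: chain_module_def mem_chains[OF sub])
  have g0: "g \<sigma> = \<zero>" if "\<sigma> \<notin> faces Y (i - 1)" for \<sigma>
    using g that by (simp add: chain_module_def mem_chains[OF sub])
  have JV: "J \<sigma> \<subseteq> V" for \<sigma>
    using Y by (auto simp: J_def)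
  have closed: "insert j \<sigma> \<in> faces Y i" if "\<sigma> \<in> faces Y (i - 1)" "j \<in> J \<sigma>" for \<sigma> j
    using that Y by (auto simp: faces_def J_def face_dim_insert)
  note basis = finsum_basis_vec[where A = "faces Y i" and S = "faces Y (i - 1)" and f = g
      and c = "\<lambda>j \<sigma>. sgn j (insert j \<sigma>)" and J = J and t = "\<lambda>j \<sigma>. insert j \<sigma>",
      OF sub finite_faces[OF sub] gc sgn_closed finite_subset[OF JV finite_V] closed]
  show ?thesis
  proof (cases "\<tau> \<in> faces Y i")
    case False
    then show ?thesis
      using basis(1)
      by (auto simp: coboundary_def Let_def chain_module_def mem_chains[OF sub] J_def
          simp del: free_module_simps)
  next
    case True
    then have \<tau>: "\<tau> \<in> Y" "\<tau> \<subseteq> V" using Y by (auto simp: faces_def)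
    have "coboundary R \<nu> Y i g \<tau> = (\<Oplus>\<sigma>\<in>faces Y (i - 1). g \<sigma> \<otimes>
        (\<Oplus>j\<in>J \<sigma>. sgn j (insert j \<sigma>) \<otimes> basis_vec R (insert j \<sigma>) \<tau>))"
      using basis(2)[of \<tau>]
      by (simp add: coboundary_def Let_def chain_module_def J_def del: free_module_simps)
    also have "\<dots> = (\<Oplus>j\<in>\<tau>. sgn j (insert j (\<tau> - {j})) \<otimes> g (\<tau> - {j}))"
      using sub g0 gc finite_V \<tau> JV
      by (intro finsum_incidence[where W = V] finite_faces[OF sub]) (auto simp: J_def insert_absorb)
    also have "\<dots> = (\<Oplus>j\<in>\<tau>. sgn j \<tau> \<otimes> g (\<tau> - {j}))"
      using gc by (intro finsum_cong') (auto simp: insert_absorb)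
    finally show ?thesis
      using True by simp
  qed
qed

lemma linear_map_coboundary:
  assumes Y: "Y \<subseteq> Pow V"
  shows "linear_map R (chain_module R Y (i - 1)) (chain_module R Y i) (coboundary R \<nu> Y i)"
proof (rule linear_mapI)
  interpret C: module R "chain_module R Y (i - 1)"
    unfolding chain_module_def by (rule module_free_module[OF cring_axioms])
  note sub = faces_subset[OF Y]
  have fin: "finite \<tau>" if "\<tau> \<in> faces Y i" for \<tau>
    using that sub finite_V by (meson PowD finite_subset subsetD)
  fix f assume f: "f \<in> carrier (chain_module R Y (i - 1))"
  then have fc: "f \<sigma> \<in> carrier R" for \<sigma>
    by (simp add: chain_module_def mem_chains[OF sub])
  show "coboundary R \<nu> Y i f \<in> carrier (chain_module R Y i)"
    using fc by (auto simp: coboundary_apply[OF Y f] chain_module_def mem_chains[OF sub]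
        intro!: finsum_closed)
  show "coboundary R \<nu> Y i (f \<oplus>\<^bsub>chain_module R Y (i - 1)\<^esub> g) =
      coboundary R \<nu> Y i f \<oplus>\<^bsub>chain_module R Y i\<^esub> coboundary R \<nu> Y i g"
    if g: "g \<in> carrier (chain_module R Y (i - 1))" for g
  proof -
    have gc: "g \<sigma> \<in> carrier R" for \<sigma>
      using g by (simp add: chain_module_def mem_chains[OF sub])
    note sum_apply = coboundary_apply[OF Y C.a_closed[OF f g], unfolded chain_module_def free_module_simps]
    show ?thesis
      using fc gc
      by (simp add: fun_eq_iff coboundary_apply[OF Y f] coboundary_apply[OF Y g] sum_apply
          chain_module_def r_distr finsum_addf Pi_iff)
  qed
  show "coboundary R \<nu> Y i (a \<odot>\<^bsub>chain_module R Y (i - 1)\<^esub> f) =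
      a \<odot>\<^bsub>chain_module R Y i\<^esub> coboundary R \<nu> Y i f" if a: "a \<in> carrier R" for a
  proof -
    note scaled_apply =
      coboundary_apply[OF Y C.smult_closed[OF a f], unfolded chain_module_def free_module_simps]
    show ?thesis
      using fc a fin
      by (simp add: fun_eq_iff coboundary_apply[OF Y f] scaled_apply chain_module_def m_lcomm
          finsum_rdistr Pi_iff)
  qed
qed

section \<open>Complementation\<close>

lemma complement_face_iff:
  assumes "\<tau> \<subseteq> V"
  shows "V - \<tau> \<in> faces (Pow V - X) i \<longleftrightarrow> \<tau> \<in> faces (alexander_dual V X) (int (card V) - i - 2)"
  using assms by (auto simp: faces_def alexander_dual_def face_dim_complement)

lemma alexander_dual_subset: "alexander_dual V X \<subseteq> Pow V"
  by (auto simp: alexander_dual_def)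

lemma complement_chain_mem:
  assumes "h \<in> carrier (free_module R (faces (Pow V - X) i))"
  shows "complement_chain h \<in> carrier (chain_module R (alexander_dual V X) (int (card V) - i - 2))"
proof -
  have "linear_map R (free_module R (faces (Pow V - X) i))
      (free_module R (faces (alexander_dual V X) (int (card V) - i - 2))) complement_chain"
    by (rule linear_map_complement_chain)
      (auto simp: complement_face_iff intro!: faces_subset alexander_dual_subset)
  from linear_mapD(1)[OF this assms] show ?thesis
    by (simp add: chain_module_def)
qed

lemma inj_complement_chain:
  assumes "f \<in> carrier (free_module R (Pow V))" "g \<in> carrier (free_module R (Pow V))"
    and "complement_chain f = complement_chain g"
  shows "f = g"
proof
  fix \<sigma>
  show "f \<sigma> = g \<sigma>"
  proof (cases "\<sigma> \<subseteq> V")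
    case True
    then have "V - (V - \<sigma>) = \<sigma>" by auto
    then have "dual_sgn (V - \<sigma>) \<otimes> f \<sigma> = dual_sgn (V - \<sigma>) \<otimes> g \<sigma>"
      using fun_cong[OF assms(3), of "V - \<sigma>"] by (simp add: complement_chain_def)
    then have "dual_sgn (V - \<sigma>) \<otimes> (dual_sgn (V - \<sigma>) \<otimes> f \<sigma>) =
        dual_sgn (V - \<sigma>) \<otimes> (dual_sgn (V - \<sigma>) \<otimes> g \<sigma>)"
      by simp
    then show ?thesis
      using assms(1,2) by (simp add: mem_chains m_assoc[symmetric] dual_sgn_dual_sgn)
  qed (use assms in \<open>simp add: mem_chains\<close>)
qed

lemma complement_chain_onto:
  assumes y: "y \<in> carrier (chain_module R (alexander_dual V X) (int (card V) - i - 2))"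
  obtains h where "h \<in> carrier (free_module R (faces (Pow V - X) i))" "y = complement_chain h"
proof
  note sub = faces_subset[OF alexander_dual_subset]
  have sub': "faces (Pow V - X) i \<subseteq> Pow V" by (rule faces_subset) auto
  define h where "h \<sigma> = (if \<sigma> \<subseteq> V then dual_sgn (V - \<sigma>) \<otimes> y (V - \<sigma>) else \<zero>)" for \<sigma>
  have yc: "y \<tau> \<in> carrier R" for \<tau>
    using y by (simp add: chain_module_def mem_chains[OF sub])
  have y0: "y \<tau> = \<zero>" if "\<tau> \<notin> faces (alexander_dual V X) (int (card V) - i - 2)" for \<tau>
    using y that by (simp add: chain_module_def mem_chains[OF sub])
  have "h \<sigma> = \<zero>" if "\<sigma> \<notin> faces (Pow V - X) i" for \<sigma>
  proof (cases "\<sigma> \<subseteq> V")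
    case True
    then have "V - \<sigma> \<notin> faces (alexander_dual V X) (int (card V) - i - 2)"
      using that complement_face_iff[of "V - \<sigma>" X i] by (simp add: double_diff)
    then show ?thesis by (simp add: h_def y0)
  qed (simp add: h_def)
  then show "h \<in> carrier (free_module R (faces (Pow V - X) i))"
    using yc by (simp add: mem_chains[OF sub']) (simp add: h_def)
  show "y = complement_chain h"
  proof
    fix \<tau>
    show "y \<tau> = complement_chain h \<tau>"
    proof (cases "\<tau> \<subseteq> V")
      case True
      then have "V - (V - \<tau>) = \<tau>" by auto
      with True show ?thesis
        using yc by (simp add: complement_chain_def h_def m_assoc[symmetric] dual_sgn_dual_sgn)
    next
      case False
      then have "\<tau> \<notin> faces (alexander_dual V X) (int (card V) - i - 2)"
        using sub by auto
      then show ?thesis using False by (simp add: complement_chain_def y0)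
    qed
  qed
qed

text \<open>Complementation turns removing a vertex into inserting it. It therefore identifies the cochain complex
  of the dual with the relative chain complex of the full simplex modulo \<open>X\<close>, whose basis is formed by
  the non-faces.\<close>

lemma coboundary_complement_chain:
  assumes h: "h \<in> carrier (free_module R (faces (Pow V - X) i))"
  shows "coboundary R \<nu> (alexander_dual V X) (int (card V) - i - 1) (complement_chain h) =
    complement_chain (restrict_chain (Pow V - X) (del h))"
proof
  fix \<tau>
  have sub: "faces (Pow V - X) i \<subseteq> Pow V" by (rule faces_subset) auto
  have hc: "h \<sigma> \<in> carrier R" for \<sigma>
    using h by (simp add: mem_chains[OF sub])
  have h0: "h \<sigma> = \<zero>" if "\<sigma> \<notin> faces (Pow V - X) i" for \<sigma>
    using h that by (simp add: mem_chains[OF sub])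
  let ?Y = "alexander_dual V X" and ?k = "int (card V) - i - 1"
  have "complement_chain h \<in> carrier (chain_module R ?Y (?k - 1))"
    using complement_chain_mem[OF h] by (simp add: algebra_simps)
  note apply_eq = coboundary_apply[OF alexander_dual_subset this, of \<tau>]
  show "coboundary R \<nu> ?Y ?k (complement_chain h) \<tau> =
      complement_chain (restrict_chain (Pow V - X) (del h)) \<tau>"
  proof (cases "\<tau> \<in> ?Y")
    case False
    then show ?thesis
      using apply_eq
      by (auto simp: faces_def complement_chain_def restrict_chain_def alexander_dual_def)
  next
    case True
    then have \<tau>: "\<tau> \<subseteq> V" "V - \<tau> \<notin> X" "V - (V - \<tau>) = \<tau>"
      by (auto simp: alexander_dual_def)
    have fin: "finite \<tau>" using \<tau> finite_V by (auto intro: finite_subset)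
    have rhs: "complement_chain (restrict_chain (Pow V - X) (del h)) \<tau> =
        (\<Oplus>j\<in>\<tau>. dual_sgn \<tau> \<otimes> (sgn j (insert j (V - \<tau>)) \<otimes> h (insert j (V - \<tau>))))"
      using \<tau> hc fin
      by (simp add: complement_chain_def restrict_chain_def del_def finsum_rdistr Pi_iff)
    have summand: "sgn j \<tau> \<otimes> complement_chain h (\<tau> - {j}) =
        dual_sgn \<tau> \<otimes> (sgn j (insert j (V - \<tau>)) \<otimes> h (insert j (V - \<tau>)))" if j: "j \<in> \<tau>" for j
    proof -
      have "V - (\<tau> - {j}) = insert j (V - \<tau>)" "\<tau> - {j} \<subseteq> V"
        using j \<tau> by auto
      then show ?thesis
        using hc dual_sgn_remove[OF \<tau>(1) j]
        by (simp add: complement_chain_def m_assoc[symmetric])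
    qed
    show ?thesis
    proof (cases "\<tau> \<in> faces ?Y ?k")
      case True
      then show ?thesis
        unfolding apply_eq rhs using summand hc
        by (simp, intro finsum_cong') auto
    next
      case False
      have "h (insert j (V - \<tau>)) = \<zero>" if "j \<in> \<tau>" for j
      proof (rule h0)
        have "face_dim (insert j (V - \<tau>)) = face_dim (V - \<tau>) + 1"
          using that \<tau> by (intro face_dim_insert) auto
        then show "insert j (V - \<tau>) \<notin> faces (Pow V - X) i"
          using False True \<tau> by (auto simp: faces_def face_dim_complement)
      qed
      then have "(\<Oplus>j\<in>\<tau>. dual_sgn \<tau> \<otimes> (sgn j (insert j (V - \<tau>)) \<otimes> h (insert j (V - \<tau>)))) =
          (\<Oplus>j\<in>\<tau>. \<zero>)"
        by (intro finsum_cong') auto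
      then show ?thesis
        using False by (simp add: apply_eq rhs)
    qed
  qed
qed

section \<open>Alexander duality\<close>

lemma contracted_complex_simplex:
  assumes X: "simplicial_complex_on V X" and v: "v \<in> V"
  shows "contracted_complex (free_module R (Pow V)) del (cone v) (restrict_chain (Pow V - X))"
proof -
  let ?G = "free_module R (Pow V)"
  have XV: "X \<subseteq> Pow V" and down: "\<And>\<sigma> \<tau>. \<sigma> \<in> X \<Longrightarrow> \<tau> \<subseteq> \<sigma> \<Longrightarrow> \<tau> \<in> X"
    using X by (auto simp: simplicial_complex_on_def)
  interpret G: module R ?G
    by (rule module_free_module[OF cring_axioms])
  have homI: "abelian_group_hom ?G ?G h" if "linear_map R ?G ?G h" for h
    using G.module_axioms G.module_axioms that by (rule linear_map_imp_abelian_group_hom)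
  have homs: "abelian_group_hom ?G ?G del" "abelian_group_hom ?G ?G (cone v)"
      "abelian_group_hom ?G ?G (restrict_chain (Pow V - X))"
    using v by (auto intro!: homI linear_map_del linear_map_cone linear_map_restrict_chain)
  show ?thesis
  proof (intro contracted_complex.intro contracted_complex_axioms.intro homs G.abelian_group_axioms)
    fix f assume f: "f \<in> carrier ?G"
    show "del (del f) = \<zero>\<^bsub>?G\<^esub>"
      using f by (simp add: del_del)
    show "del (cone v f) \<oplus>\<^bsub>?G\<^esub> cone v (del f) = f"
      using f v by (simp add: del_cone)
    have "insert j \<tau> \<notin> X" if "\<tau> \<notin> X" for j \<tau>
      using that down[of "insert j \<tau>" \<tau>] by blast
    then show "restrict_chain (Pow V - X) (del (restrict_chain (Pow V - X) f)) =
        restrict_chain (Pow V - X) (del f)"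
      using f by (auto simp: restrict_chain_def del_def fun_eq_iff mem_chains intro!: finsum_cong')
  qed
qed

text \<open>The isomorphism is induced by \<open>\<phi>\<close>, which cones a cycle off to \<open>v\<close>, drops the faces of \<open>X\<close> and
  complements. Any vertex can serve as the apex, but there has to be one: over an empty ground set the
  full simplex is the complex \<open>{{}}\<close>, which is not contractible.\<close>

lemma module_isomorphic_alexander_dual:
  assumes X: "simplicial_complex_on V X" and v: "v \<in> V"
  shows "module_isomorphic R (reduced_homology R \<nu> X i)
    (reduced_cohomology R \<nu> (alexander_dual V X) (int (card V) - i - 3))"
proof -
  define Y k where "Y = alexander_dual V X" and "k = int (card V) - i - 3"
  \<comment> \<open>The non-faces: chains on \<open>N\<close> represent the full simplex modulo \<open>X\<close>.\<close>
  define N where "N = Pow V - X"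
  have XV: "X \<subseteq> Pow V" and NV: "N \<subseteq> Pow V" and YV: "Y \<subseteq> Pow V"
    using X alexander_dual_subset by (auto simp: simplicial_complex_on_def N_def Y_def)
  let ?G = "free_module R (Pow V)"
  interpret G: module R ?G
    by (rule module_free_module[OF cring_axioms])
  interpret contracted_complex ?G del "cone v" "restrict_chain N"
    unfolding N_def using X v by (rule contracted_complex_simplex)
  have chain_in: "f \<in> carrier ?G" if "f \<in> carrier (free_module R A)" "A \<subseteq> Pow V" for f A
    using that by (auto simp: mem_chains)
  have restrict_zero: "restrict_chain N f = \<zero>\<^bsub>?G\<^esub> \<longleftrightarrow> (\<forall>\<sigma>\<in>N. f \<sigma> = \<zero>)" for f
    by (auto simp: restrict_chain_def fun_eq_iff)

  let ?C = "chain_module R X i" and ?d = "boundary R \<nu> X i" and ?d' = "boundary R \<nu> X (i + 1)"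
  let ?D = "chain_module R Y k" and ?e = "coboundary R \<nu> Y k" and ?e' = "coboundary R \<nu> Y (k + 1)"
  define Z where "Z = a_kernel ?C (chain_module R X (i - 1)) ?d"
  define B where "B = ?d' ` carrier (chain_module R X (i + 1))"
  define Z' where "Z' = a_kernel ?D (chain_module R Y (k + 1)) ?e'"
  define B' where "B' = ?e ` carrier (chain_module R Y (k - 1))"

  \<comment> \<open>Cycles and boundaries on both sides, expressed through \<open>del\<close>, restriction to non-faces and
    complementation.\<close>
  have Z: "f \<in> Z \<longleftrightarrow> f \<in> carrier (free_module R (faces X i)) \<and> del f = \<zero>\<^bsub>?G\<^esub>" for f
    unfolding Z_def mem_a_kernel chain_module_def free_module_simps
    using boundary_eq_del[OF X, of f i] unfolding chain_module_def by auto
  have B: "B = del ` carrier (free_module R (faces X (i + 1)))"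
    using boundary_eq_del[OF X, of _ "i + 1"] by (auto simp: B_def chain_module_def)
  have e': "?e' (complement_chain h) = complement_chain (restrict_chain N (del h))"
    if "h \<in> carrier (free_module R (faces N (i + 1)))" for h
    using coboundary_complement_chain[of h X "i + 1"] that by (simp add: k_def N_def Y_def)
  have e: "?e (complement_chain h) = complement_chain (restrict_chain N (del h))"
    if "h \<in> carrier (free_module R (faces N (i + 2)))" for h
    using coboundary_complement_chain[of h X "i + 2"] that by (simp add: k_def N_def Y_def)
  have complement_D: "complement_chain h \<in> carrier ?D"
    if "h \<in> carrier (free_module R (faces N (i + 1)))" for h
    using complement_chain_mem[of h X "i + 1"] that by (simp add: k_def N_def Y_def)
  have complement_zero: "complement_chain f = \<zero>\<^bsub>?G\<^esub> \<longleftrightarrow> f = \<zero>\<^bsub>?G\<^esub>" if "f \<in> carrier ?G" for f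
  proof -
    have "complement_chain \<zero>\<^bsub>?G\<^esub> = \<zero>\<^bsub>?G\<^esub>"
      by (auto simp: complement_chain_def)
    then show ?thesis
      using inj_complement_chain[OF that G.M.zero_closed] by auto
  qed
  have Z': "complement_chain h \<in> Z' \<longleftrightarrow> restrict_chain N (del h) = \<zero>\<^bsub>?G\<^esub>"
    if h: "h \<in> carrier (free_module R (faces N (i + 1)))" for h
  proof -
    have "restrict_chain N (del h) \<in> carrier ?G"
      using chain_in[OF h faces_subset[OF NV]] by simp
    then show ?thesis
      using complement_D[OF h] complement_zero
      unfolding Z'_def mem_a_kernel e'[OF h] chain_module_def free_module_simps by blast
  qed
  have Z'_onto: "\<exists>h\<in>carrier (free_module R (faces N (i + 1))). y = complement_chain h" if "y \<in> Z'" for y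
  proof -
    have "y \<in> carrier (chain_module R (alexander_dual V X) (int (card V) - (i + 1) - 2))"
      using that unfolding Z'_def mem_a_kernel k_def Y_def by (simp add: algebra_simps)
    from complement_chain_onto[OF this] show ?thesis
      unfolding N_def by blast
  qed
  have B': "B' = (\<lambda>h. complement_chain (restrict_chain N (del h))) `
      carrier (free_module R (faces N (i + 2)))"
  proof -
    have "carrier (chain_module R Y (k - 1)) =
        complement_chain ` carrier (free_module R (faces N (i + 2)))"
      using complement_chain_onto[of _ X "i + 2"] complement_chain_mem[of _ X "i + 2"]
      by (auto simp: k_def N_def Y_def)
    then show ?thesis
      by (auto simp: B'_def e image_image intro!: image_cong)
  qed

  have lin_del: "linear_map R (free_module R (faces N (j + 1))) (free_module R (faces (Pow V) j)) del" for j
    using NV by (intro linear_map_del) (auto simp: faces_def face_dim_insert)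
  have dim_cone: "face_dim \<sigma> = face_dim (\<sigma> - {v}) + 1" if "v \<in> \<sigma>" "\<sigma> - {v} \<subseteq> V" for \<sigma>
  proof -
    have "\<sigma> \<subseteq> V" using that v by blast
    then show ?thesis using face_dim_remove[of \<sigma> v] that by simp
  qed
  have lin_cone: "linear_map R (free_module R (faces (Pow V) j)) (free_module R (faces (Pow V) (j + 1)))
      (cone v)" for j
    using v by (intro linear_map_cone) (auto simp: faces_def dim_cone)
  have lin_restrict: "linear_map R (free_module R (faces (Pow V) j)) (free_module R (faces N j))
      (restrict_chain N)" for j
    using NV by (intro linear_map_restrict_chain) (auto simp: faces_def)
  have lin_complement: "linear_map R (free_module R (faces N (i + 1))) ?D complement_chain"
    unfolding chain_module_def
  proof (rule linear_map_complement_chain)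
    show "\<tau> \<in> faces Y k" if "\<tau> \<subseteq> V" "V - \<tau> \<in> faces N (i + 1)" for \<tau>
      using that complement_face_iff[of \<tau> X "i + 1"] by (simp add: k_def N_def Y_def)
  qed (simp_all add: faces_subset NV YV)

  define \<phi> where "\<phi> f = complement_chain (restrict_chain N (cone v f))" for f
  have chain_dim: "f \<in> carrier (free_module R (faces (Pow V) j))"
    if "f \<in> carrier (free_module R (faces A j))" "A \<subseteq> Pow V" for f A j
    using that faces_subset[of A] faces_subset[of "Pow V"]
    by (auto simp: mem_chains faces_def)
  have chain_X: "f \<in> carrier (free_module R (faces X j))"
    if "f \<in> carrier (free_module R (faces (Pow V) j))" "restrict_chain N f = \<zero>\<^bsub>?G\<^esub>" for f j
  proof -
    have fc: "f \<sigma> \<in> carrier R" and f0: "\<sigma> \<notin> faces (Pow V) j \<Longrightarrow> f \<sigma> = \<zero>" for \<sigma>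
      using that(1) faces_subset[of "Pow V"] by (simp_all add: mem_chains)
    have "f \<sigma> = \<zero>" if "\<sigma> \<notin> faces X j" for \<sigma>
    proof (cases "\<sigma> \<in> N")
      case True
      then show ?thesis
        using \<open>restrict_chain N f = \<zero>\<^bsub>?G\<^esub>\<close>[unfolded restrict_zero] by blast
    next
      case False
      then show ?thesis
        using that by (intro f0) (auto simp: faces_def N_def)
    qed
    then show ?thesis
      using fc faces_subset[OF XV] by (simp add: mem_chains)
  qed
  have restrict_X: "restrict_chain N f = \<zero>\<^bsub>?G\<^esub>" if "f \<in> carrier (free_module R (faces X j))" for f j
    unfolding restrict_zero using that faces_subset[OF XV] by (auto simp: mem_chains N_def faces_def)
  have cone_dim: "restrict_chain N (cone v f) \<in> carrier (free_module R (faces N (j + 1)))"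
    if "f \<in> carrier (free_module R (faces A j))" "A \<subseteq> Pow V" for f A j
    using linear_mapD(1)[OF lin_restrict linear_mapD(1)[OF lin_cone chain_dim[OF that]]] .
  have del_dim: "del h \<in> carrier (free_module R (faces (Pow V) j))"
    if "h \<in> carrier (free_module R (faces N (j + 1)))" for h j
    using linear_mapD(1)[OF lin_del that] .
  have two: "i + 1 + 1 = i + 2" by simp
  note del_dim2 = del_dim[of _ "i + 1", unfolded two]
    and cone_dim2 = cone_dim[of _ _ "i + 1", unfolded two]
  have \<phi>_lin: "linear_map R ?C ?D \<phi>"
  proof -
    have "linear_map R ?C (free_module R (faces (Pow V) (i + 1))) (cone v)"
      unfolding chain_module_def using XV v
      by (intro linear_map_cone faces_subset) (auto simp: faces_def dim_cone subset_iff)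
    from linear_map_compose[OF linear_map_compose[OF this lin_restrict] lin_complement]
    show ?thesis by (simp add: \<phi>_def[abs_def])
  qed

  have C: "module R ?C" and D: "module R ?D"
    by (simp_all add: chain_module_def module_free_module[OF cring_axioms])
  have Z_sub: "submodule Z R ?C"
    unfolding Z_def chain_module_def
    by (intro submodule_kernel module_free_module[OF cring_axioms]
        linear_map_boundary[OF X, unfolded chain_module_def])
  have B_sub: "submodule B R ?C"
    unfolding B_def chain_module_def using linear_map_boundary[OF X, of "i + 1"]
    by (intro submodule_image module_free_module[OF cring_axioms]) (simp add: chain_module_def)
  have Z'_sub: "submodule Z' R ?D"
    unfolding Z'_def chain_module_def using linear_map_coboundary[OF YV, of "k + 1"]
    by (intro submodule_kernel module_free_module[OF cring_axioms]) (simp add: chain_module_def)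
  have B'_sub: "submodule B' R ?D"
    unfolding B'_def chain_module_def
    by (intro submodule_image module_free_module[OF cring_axioms]
        linear_map_coboundary[OF YV, unfolded chain_module_def])
  have "B \<subseteq> Z"
  proof
    fix f assume "f \<in> B"
    then obtain u where u: "u \<in> carrier (free_module R (faces X (i + 1)))" "f = del u"
      unfolding B by blast
    have "f \<in> carrier ?C"
      using module.submoduleE(1)[OF C B_sub] \<open>f \<in> B\<close> by blast
    then show "f \<in> Z"
      using u(2) D_D[OF chain_in[OF u(1) faces_subset[OF XV]]] by (simp add: Z chain_module_def)
  qed
  have "B' \<subseteq> Z'"
  proof
    fix y assume "y \<in> B'"
    then obtain h where h: "h \<in> carrier (free_module R (faces N (i + 2)))"
        "y = complement_chain (restrict_chain N (del h))"
      unfolding B' by blast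
    have hG: "h \<in> carrier ?G"
      using h(1) faces_subset[OF NV] by (rule chain_in)
    have "restrict_chain N (del h) \<in> carrier (free_module R (faces N (i + 1)))"
      using h(1) by (intro linear_mapD(1)[OF lin_restrict] del_dim2)
    then show "y \<in> Z'"
      using hG by (simp add: h(2) Z' P_D_P D_D del: free_module_simps)
  qed

  have "module_isomorphic R (quotient_module (?C\<lparr>carrier := Z\<rparr>) B) (quotient_module (?D\<lparr>carrier := Z'\<rparr>) B')"
  proof (rule module_isomorphic_quotientsI[where h = \<phi>])
    show "module R (?C\<lparr>carrier := Z\<rparr>)" "module R (?D\<lparr>carrier := Z'\<rparr>)"
      using Z_sub Z'_sub C D by (auto intro: submodule.submodule_is_module)
    show "submodule B R (?C\<lparr>carrier := Z\<rparr>)" "submodule B' R (?D\<lparr>carrier := Z'\<rparr>)"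
      by (intro submodule_restrict_carrier C D Z_sub B_sub Z'_sub B'_sub \<open>B \<subseteq> Z\<close> \<open>B' \<subseteq> Z'\<close>)+
    have "\<phi> f \<in> Z'" if "f \<in> Z" for f
    proof -
      have f: "f \<in> carrier (free_module R (faces X i))" "del f = \<zero>\<^bsub>?G\<^esub>"
        using that by (simp_all add: Z)
      have "restrict_chain N (del (restrict_chain N (cone v f))) = \<zero>\<^bsub>?G\<^esub>"
        using chain_in[OF f(1) faces_subset[OF XV]] f(2) restrict_X[OF f(1)]
        by (rule relative_cycle_cone)
      then show ?thesis
        using cone_dim[OF f(1) XV] by (simp add: \<phi>_def Z')
    qed
    then show "linear_map R (?C\<lparr>carrier := Z\<rparr>) (?D\<lparr>carrier := Z'\<rparr>) \<phi>"
      by (intro linear_map_restrict_carrier[OF \<phi>_lin]) (auto simp: Z chain_module_def)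
  next
    fix f assume "f \<in> carrier (?C\<lparr>carrier := Z\<rparr>)"
    then have f: "f \<in> carrier (free_module R (faces X i))" "del f = \<zero>\<^bsub>?G\<^esub>"
      by (simp_all add: Z)
    note fG = chain_in[OF f(1) faces_subset[OF XV]]
    show "\<phi> f \<in> B' \<longleftrightarrow> f \<in> B"
    proof
      assume "\<phi> f \<in> B'"
      then obtain h where h: "h \<in> carrier (free_module R (faces N (i + 2)))"
          "\<phi> f = complement_chain (restrict_chain N (del h))"
        unfolding B' by blast
      have hG: "h \<in> carrier ?G"
        using h(1) faces_subset[OF NV] by (rule chain_in)
      have eq: "restrict_chain N (cone v f) = restrict_chain N (del h)"
      proof (rule inj_complement_chain)
        show "restrict_chain N (cone v f) \<in> carrier ?G" "restrict_chain N (del h) \<in> carrier ?G"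
          by (rule P.hom_closed[OF K.hom_closed[OF fG]], rule P.hom_closed[OF D.hom_closed[OF hG]])
        show "complement_chain (restrict_chain N (cone v f)) = complement_chain (restrict_chain N (del h))"
          using h(2) unfolding \<phi>_def .
      qed
      \<comment> \<open>\<open>u\<close> is a chain of \<open>X\<close>, since its coefficients at non-faces cancel by \<open>eq\<close>.\<close>
      define u where "u = cone v f \<ominus>\<^bsub>?G\<^esub> del h"
      have "cone v f \<in> carrier (free_module R (faces (Pow V) (i + 1)))"
        using chain_dim[OF f(1) XV] by (rule linear_mapD(1)[OF lin_cone])
      moreover have "del h \<in> carrier (free_module R (faces (Pow V) (i + 1)))"
        using h(1) by (rule del_dim2)
      ultimately have "u \<in> carrier (free_module R (faces (Pow V) (i + 1)))"
        unfolding u_def a_minus_def uminus_chain[OF D.hom_closed[OF hG]] free_module_simps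
        using faces_subset[of "Pow V"] by (simp add: mem_chains)
      then have "u \<in> carrier (free_module R (faces X (i + 1)))"
        using boundary_if_relative_boundary_cone(2)[OF fG f(2) hG eq] unfolding u_def[symmetric]
        by (rule chain_X)
      moreover have "del u = f"
        unfolding u_def using fG f(2) hG eq by (rule boundary_if_relative_boundary_cone(1))
      ultimately show "f \<in> B"
        unfolding B by blast
    next
      assume "f \<in> B"
      then obtain u where u: "u \<in> carrier (free_module R (faces X (i + 1)))" "f = del u"
        unfolding B by blast
      note uG = chain_in[OF u(1) faces_subset[OF XV]]
      have "\<ominus>\<^bsub>?G\<^esub> u \<in> carrier (free_module R (faces X (i + 1)))"
        using u(1) faces_subset[OF XV] by (simp add: uminus_chain[OF uG] mem_chains)
      then have "restrict_chain N (cone v (\<ominus>\<^bsub>?G\<^esub> u)) \<in> carrier (free_module R (faces N (i + 2)))"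
        using XV by (rule cone_dim2)
      moreover have "\<phi> f = complement_chain (restrict_chain N (del (restrict_chain N (cone v (\<ominus>\<^bsub>?G\<^esub> u)))))"
        unfolding \<phi>_def u(2) using relative_boundary_cone[OF uG restrict_X[OF u(1)]] by simp
      ultimately show "\<phi> f \<in> B'"
        unfolding B' by blast
    qed
  next
    fix y assume "y \<in> carrier (?D\<lparr>carrier := Z'\<rparr>)"
    then have "y \<in> Z'" by simp
    then obtain h where h: "h \<in> carrier (free_module R (faces N (i + 1)))" "y = complement_chain h"
      using Z'_onto by blast
    have rel: "restrict_chain N (del h) = \<zero>\<^bsub>?G\<^esub>"
      using \<open>y \<in> Z'\<close> h by (simp add: Z')
    have hG: "h \<in> carrier ?G"
      using h(1) faces_subset[OF NV] by (rule chain_in)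
    have "del h \<in> carrier (free_module R (faces X i))"
      using del_dim[OF h(1)] rel by (rule chain_X)
    then have "del h \<in> Z"
      using D_D[OF hG] by (simp add: Z)
    moreover have "y \<in> B' +>\<^bsub>?D\<lparr>carrier := Z'\<rparr>\<^esub> \<phi> (del h)"
    proof -
      \<comment> \<open>\<open>b\<close> is the relative chain whose boundary separates \<open>h\<close> from the image of the cycle \<open>del h\<close>.\<close>
      define b where "b = restrict_chain N (cone v h)"
      have b: "b \<in> carrier (free_module R (faces N (i + 2)))"
        unfolding b_def using h(1) NV by (rule cone_dim2)
      have b': "restrict_chain N (del b) \<in> carrier (free_module R (faces N (i + 1)))"
        using b by (intro linear_mapD(1)[OF lin_restrict] del_dim2)
      have "restrict_chain N h = h"
        using h(1) faces_subset[OF NV] by (auto simp: restrict_chain_def mem_chains faces_def)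
      then have "h = restrict_chain N (del b) \<oplus>\<^bsub>?G\<^esub> restrict_chain N (cone v (del h))"
        unfolding b_def using relative_cycle_homologous[OF hG] by simp
      then have "y = complement_chain (restrict_chain N (del b)) \<oplus>\<^bsub>?D\<^esub> \<phi> (del h)"
        using linear_mapD(2)[OF lin_complement b' cone_dim[OF \<open>del h \<in> carrier (free_module R (faces X i))\<close> XV]]
        by (simp add: h(2) \<phi>_def)
      moreover have "complement_chain (restrict_chain N (del b)) \<in> B'"
        unfolding B' using b by blast
      ultimately show ?thesis
        unfolding a_r_coset_def' by auto
    qed
    ultimately show "\<exists>f\<in>carrier (?C\<lparr>carrier := Z\<rparr>). y \<in> B' +>\<^bsub>?D\<lparr>carrier := Z'\<rparr>\<^esub> \<phi> f"
      by auto
  qed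
  moreover have "reduced_homology R \<nu> X i = quotient_module (?C\<lparr>carrier := Z\<rparr>) B"
    by (simp only: reduced_homology_def Z_def B_def)
  moreover have "reduced_cohomology R \<nu> Y k = quotient_module (?D\<lparr>carrier := Z'\<rparr>) B'"
    by (simp only: reduced_cohomology_def Z'_def B'_def)
  ultimately show ?thesis
    by (simp add: Y_def k_def)
qed

end

theorem theorem1p1:
  fixes R :: "('r, 'm) ring_scheme"
    and V :: "'v set"
    and X :: "'v set set"
    and \<nu> :: "'v \<Rightarrow> nat"
    and n :: nat
  assumes "cring R"
    and "simplicial_complex_on V X"
    and "card V = n"
    and "n \<ge> 1"
    and "bij_betw \<nu> V {1..n}"
  shows "\<forall>i::int. module_isomorphic R
           (reduced_homology R \<nu> X i)
           (reduced_cohomology R \<nu> (alexander_dual V X) (int n - i - 3))"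
proof
  fix i
  interpret ordered_vertices R V \<nu>
    using assms by (intro ordered_vertices.intro ordered_vertices_axioms.intro)
      (auto simp: simplicial_complex_on_def bij_betw_def)
  from assms(3,4) obtain v where "v \<in> V"
    by (metis card.empty ex_in_conv not_one_le_zero)
  then show "module_isomorphic R (reduced_homology R \<nu> X i)
      (reduced_cohomology R \<nu> (alexander_dual V X) (int n - i - 3))"
    using module_isomorphic_alexander_dual[OF assms(2)] assms(3) by simp
qed

end
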